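(* Let $P\in\mathbb{C}\{x,y\}$ with $P(0,y)\not\equiv0$, having no zeros in $U\cap(\mathbb{R}\times\mathbb{H})$ for a neighborhood $U$ of the origin and no factors in common with $\bar P$, and write $P=u\prod_{j=1}^M(y+q_j(x)+x^{2L_j}\psi_j(x^{1/k}))$ as in the context. Let $K=\max\{2L_1,\dots,2L_M\}$. If $Q\in\mathbb{C}\{x,y\}$ and $Q/P\in L^{\infty}_{loc}$, then $$\frac{\partial}{\partial y}\frac{Q}{P}\in L^{\mathfrak{p}}_{loc}\quad\text{for all }1\le\mathfrak{p}<1+1/K.$$
   Context: $\mathbb{H}=\{\operatorname{Im}z>0\}$, $\bar P(x,y)=\overline{P(\bar x,\bar y)}$. Such $P$ factors locally as $P=u\prod_{j=1}^M(y+q_j(x)+x^{2L_j}\psi_j(x^{1/k}))$, $M=\mathrm{Ord}(P(0,y))$, with $u$ a unit in $\mathbb{C}\{x,y\}$, $k\ge1$, $L_j\in\mathbb{N}$, $q_j\in\mathbb{R}[x]$, $q_j(0)=0$, $\deg q_j<2L_j$, $\psi_j\in\mathbb{C}\{x\}$, $\operatorname{Im}\psi_j(0)>0$. $f\in L^{\mathfrak{p}}_{loc}$ means $f\in L^{\mathfrak{p}}(U')$ (Lebesgue measure) for some neighborhood $U'$ of $(0,0)$ in $\mathbb{R}^2$, $1\le\mathfrak{p}\le\infty$. *)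

theory Defs
  imports "HOL-Complex_Analysis.Complex_Analysis" "HOL-Computational_Algebra.Polynomial"
begin

text \<open>Convergent power series in two variables: a function on a neighbourhood of the
origin of C^2 given there by an (unconditionally, hence absolutely) convergent double power series.
Elements of C{x,y} are represented by such functions (only their germ at 0 matters).\<close>
definition conv2 :: "(complex \<Rightarrow> complex \<Rightarrow> complex) \<Rightarrow> bool" where
  "conv2 F \<longleftrightarrow> (\<exists>r>0. \<exists>a :: nat \<times> nat \<Rightarrow> complex. \<forall>x y. cmod x < r \<longrightarrow> cmod y < r \<longrightarrow>
      ((\<lambda>(i,j). a (i,j) * x ^ i * y ^ j) has_sum F x y) UNIV)"

definition conv1 :: "(complex \<Rightarrow> complex) \<Rightarrow> bool" where
  "conv1 f \<longleftrightarrow> (\<exists>r>0. \<exists>a :: nat \<Rightarrow> complex. \<forall>x. cmod x < r \<longrightarrow>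
      ((\<lambda>i. a i * x ^ i) has_sum f x) UNIV)"

definition conj2 :: "(complex \<Rightarrow> complex \<Rightarrow> complex) \<Rightarrow> complex \<Rightarrow> complex \<Rightarrow> complex" where
  "conj2 P x y = cnj (P (cnj x) (cnj y))"

definition divides2 :: "(complex \<Rightarrow> complex \<Rightarrow> complex) \<Rightarrow> (complex \<Rightarrow> complex \<Rightarrow> complex) \<Rightarrow> bool" where
  "divides2 D F \<longleftrightarrow> (\<exists>A. conv2 A \<and> (\<forall>\<^sub>F z in nhds (0,0). F (fst z) (snd z) = D (fst z) (snd z) * A (fst z) (snd z)))"

text \<open>P and Pbar have no common factor: every common divisor in C{x,y} is a unit
(a non-unit of C{x,y} is exactly an element vanishing at the origin).\<close>
definition no_common_factor :: "(complex \<Rightarrow> complex \<Rightarrow> complex) \<Rightarrow> (complex \<Rightarrow> complex \<Rightarrow> complex) \<Rightarrow> bool" where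
  "no_common_factor F G \<longleftrightarrow> \<not> (\<exists>D. conv2 D \<and> D 0 0 = 0 \<and> divides2 D F \<and> divides2 D G)"

definition restrR2 :: "(complex \<Rightarrow> complex \<Rightarrow> complex) \<Rightarrow> real \<times> real \<Rightarrow> complex" where
  "restrR2 F z = F (complex_of_real (fst z)) (complex_of_real (snd z))"

definition dy :: "(real \<times> real \<Rightarrow> complex) \<Rightarrow> real \<times> real \<Rightarrow> complex" where
  "dy f z = vector_derivative (\<lambda>t. f (fst z, t)) (at (snd z))"

definition Lp_loc :: "real \<Rightarrow> (real \<times> real \<Rightarrow> complex) \<Rightarrow> bool" where
  "Lp_loc p f \<longleftrightarrow> (\<exists>U. open U \<and> (0,0) \<in> U \<and> f \<in> borel_measurable (lebesgue_on U) \<and>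
      integrable (lebesgue_on U) (\<lambda>z. norm (f z) powr p))"

definition Linf_loc :: "(real \<times> real \<Rightarrow> complex) \<Rightarrow> bool" where
  "Linf_loc f \<longleftrightarrow> (\<exists>U. open U \<and> (0,0) \<in> U \<and> f \<in> borel_measurable (lebesgue_on U) \<and>
      (\<exists>C. AE z in lebesgue_on U. norm (f z) \<le> C))"

end

theory Submission
  imports Defs
begin

text \<open>
  Near the origin \<open>P(x, y) = u(x, y) \<Prod>(y - a\<^sub>j(x))\<close> for real \<open>x\<close>. The order of \<open>P(0, \<cdot>)\<close> is the number
  of branches, so all of them pass through the origin, and for \<open>x \<noteq> 0\<close> they lie in the lower half-plane.
  On the real line \<open>|y - a\<^sub>j| = |y - cnj a\<^sub>j|\<close>, so boundedness of \<open>Q/P\<close> there and the maximum principle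
  on the two half-discs give \<open>|Q| \<le> C \<Prod>|y - a\<^sub>j|\<close> above and \<open>|Q| \<le> C \<Prod>|y - cnj a\<^sub>j|\<close> below the real axis.
  Around a real point, on a disc whose radius \<open>d\<close> is at most half the distance to every \<open>a\<^sub>j\<close>, both
  products are comparable to \<open>\<Prod>|y - a\<^sub>j|\<close>, so \<open>Q/P\<close> stays bounded there and Cauchy's inequality
  bounds its \<open>y\<close>-derivative by \<open>C/d\<close>, that is, by a multiple of \<open>1 + \<Sum>1/|y - a\<^sub>j|\<close>. Finally
  \<open>|y - a\<^sub>j|\<close> dominates both \<open>|y + q\<^sub>j(x)|\<close> and \<open>|x|\<close> to the power \<open>2L\<^sub>j\<close>, and a weighted geometric mean
  of these two bounds has an integrable inverse \<open>p\<close>-th power.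
\<close>

subsection \<open>Quotients by products over roots in a half-plane\<close>

lemma norm_le_on_compact_of_frontier:
  fixes f g :: "complex \<Rightarrow> complex"
  assumes f_hol: "f holomorphic_on S" and g_hol: "g holomorphic_on S" and compact_S: "compact S"
    and g_nonzero: "\<And>y. y \<in> S \<Longrightarrow> g y \<noteq> 0"
    and frontier: "\<And>y. y \<in> frontier S \<Longrightarrow> norm (f y) \<le> C * norm (g y)"
    and y_in: "y \<in> S"
  shows "norm (f y) \<le> C * norm (g y)"
proof -
  have quotient: "(\<lambda>y. f y / g y) holomorphic_on S"
    using f_hol g_hol g_nonzero by (intro holomorphic_intros)
  have "norm (f y / g y) \<le> C"
  proof (rule maximum_modulus_frontier[of "\<lambda>y. f y / g y" S])
    show "(\<lambda>y. f y / g y) holomorphic_on interior S"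
      using quotient interior_subset by (rule holomorphic_on_subset)
    show "continuous_on (closure S) (\<lambda>y. f y / g y)"
      using quotient compact_S by (simp add: holomorphic_on_imp_continuous_on compact_imp_closed)
    show "norm (f w / g w) \<le> C" if "w \<in> frontier S" for w
    proof -
      have "w \<in> S" using that compact_S compact_imp_closed frontier_subset_closed by blast
      then show ?thesis
        using frontier[OF that] g_nonzero by (simp add: norm_divide divide_le_eq)
    qed
  qed (use compact_S y_in in \<open>auto intro: compact_imp_bounded\<close>)
  with g_nonzero[OF y_in] show ?thesis by (simp add: norm_divide divide_le_eq)
qed

lemma power_le_prod_norm_diff:
  fixes a :: "'i \<Rightarrow> 'a::real_normed_vector"
  assumes "norm y = r" "\<And>j. j \<in> I \<Longrightarrow> norm (a j) \<le> r / 2"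
  shows "(r / 2) ^ card I \<le> (\<Prod>j\<in>I. norm (y - a j))"
proof -
  have "r / 2 \<le> norm (y - a j)" if "j \<in> I" for j
    using assms(1) assms(2)[OF that] norm_triangle_ineq2[of y "a j"] by simp
  moreover have "0 \<le> r" using assms(1) norm_ge_zero[of y] by simp
  ultimately have "(\<Prod>j\<in>I. r / 2) \<le> (\<Prod>j\<in>I. norm (y - a j))"
    by (intro prod_mono) auto
  then show ?thesis by simp
qed

lemma norm_le_prod_roots_on_half_disc:
  fixes f :: "complex \<Rightarrow> complex" and a :: "'i \<Rightarrow> complex" and v :: complex
  assumes f_hol: "f holomorphic_on cball 0 r" and finite_I: "finite I"
    and v_nonzero: "v \<noteq> 0" and C_nonneg: "0 \<le> C"
    and roots: "\<And>j. j \<in> I \<Longrightarrow> v \<bullet> a j < 0" "\<And>j. j \<in> I \<Longrightarrow> norm (a j) \<le> r / 2"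
    and diameter: "\<And>y. norm y \<le> r \<Longrightarrow> v \<bullet> y = 0 \<Longrightarrow> norm (f y) \<le> C * (\<Prod>j\<in>I. norm (y - a j))"
    and circle: "\<And>y. norm y = r \<Longrightarrow> norm (f y) \<le> C * (r / 2) ^ card I"
    and y_half_disc: "norm y \<le> r" "0 \<le> v \<bullet> y"
  shows "norm (f y) \<le> C * (\<Prod>j\<in>I. norm (y - a j))"
proof -
  let ?S = "cball 0 r \<inter> {y. v \<bullet> y \<ge> 0}"
  have "norm (f y) \<le> C * norm (\<Prod>j\<in>I. y - a j)"
  proof (rule norm_le_on_compact_of_frontier[of f ?S])
    show "f holomorphic_on ?S"
      using f_hol by (rule holomorphic_on_subset) auto
    show "(\<lambda>y. \<Prod>j\<in>I. y - a j) holomorphic_on ?S"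
      by (intro holomorphic_intros)
    show "compact ?S"
      by (intro compact_Int_closed closed_halfspace_ge) auto
    show "(\<Prod>j\<in>I. w - a j) \<noteq> 0" if "w \<in> ?S" for w
      using that roots(1) finite_I by (force simp: prod_zero_iff)
    show "norm (f w) \<le> C * norm (\<Prod>j\<in>I. w - a j)" if "w \<in> frontier ?S" for w
    proof -
      have "closed ?S" by (intro closed_Int closed_cball closed_halfspace_ge)
      then have "w \<in> ?S" using that frontier_subset_closed by blast
      moreover have "norm w = r \<or> v \<bullet> w = 0"
        using that frontier_Int_subset[of "cball 0 r" "{y. v \<bullet> y \<ge> 0}"]
          frontier_halfspace_ge[of v 0] v_nonzero
        by auto
      moreover have "norm (f w) \<le> C * (\<Prod>j\<in>I. norm (w - a j))" if w: "norm w = r"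
        using circle[OF w] mult_left_mono[OF power_le_prod_norm_diff[OF w roots(2)] C_nonneg]
        by (rule order_trans)
      ultimately show ?thesis using diameter by (auto simp: prod_norm)
    qed
  qed (use y_half_disc in auto)
  then show ?thesis by (simp add: prod_norm)
qed

definition reflected_dist :: "complex \<Rightarrow> complex \<Rightarrow> real" where
  "reflected_dist y a = max (norm (y - a)) (norm (y - cnj a))"

lemma norm_le_prod_reflected_dist:
  fixes f :: "complex \<Rightarrow> complex" and a :: "'i \<Rightarrow> complex"
  assumes f_hol: "f holomorphic_on cball 0 r" and finite_I: "finite I" and C_nonneg: "0 \<le> C"
    and roots: "\<And>j. j \<in> I \<Longrightarrow> Im (a j) < 0" "\<And>j. j \<in> I \<Longrightarrow> norm (a j) \<le> r / 2"
    and real: "\<And>t::real. \<bar>t\<bar> \<le> r \<Longrightarrow> norm (f t) \<le> C * (\<Prod>j\<in>I. norm (t - a j))"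
    and circle: "\<And>y. norm y = r \<Longrightarrow> norm (f y) \<le> C * (r / 2) ^ card I"
    and y_disc: "norm y \<le> r"
  shows "norm (f y) \<le> C * (\<Prod>j\<in>I. reflected_dist y (a j))"
proof -
  have half_disc: "norm (f y) \<le> C * (\<Prod>j\<in>I. norm (y - b j))"
    if v: "v = \<i> \<or> v = - \<i>" "0 \<le> v \<bullet> y"
      and b: "\<And>j. j \<in> I \<Longrightarrow> v \<bullet> b j < 0" "\<And>j. j \<in> I \<Longrightarrow> b j = a j \<or> b j = cnj (a j)" for v b
  proof (rule norm_le_prod_roots_on_half_disc[OF f_hol finite_I _ C_nonneg b(1) _ _ circle y_disc v(2)])
    show "norm (b j) \<le> r / 2" if "j \<in> I" for j
      using b(2) roots(2) that by fastforce
    show "norm (f w) \<le> C * (\<Prod>j\<in>I. norm (w - b j))" if "norm w \<le> r" "v \<bullet> w = 0" for w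
    proof -
      have "Im w = 0" using that v by (auto simp: inner_complex_def)
      then obtain t :: real where t: "w = of_real t"
        by (metis complex_is_Real_iff Reals_cases)
      have "norm (of_real t - b j) = norm (of_real t - a j)" if "j \<in> I" for j
        using b(2)[OF that] by (metis complex_cnj_diff complex_cnj_complex_of_real complex_mod_cnj)
      then show ?thesis using real[of t] that t by simp
    qed
  qed (use v in auto)
  have le_reflected: "C * (\<Prod>j\<in>I. norm (y - b j)) \<le> C * (\<Prod>j\<in>I. reflected_dist y (a j))"
    if "\<And>j. b j = a j \<or> b j = cnj (a j)" for b
  proof (intro mult_left_mono[OF _ C_nonneg] prod_mono conjI)
    show "norm (y - b j) \<le> reflected_dist y (a j)" for j
      using that[of j] by (auto simp: reflected_dist_def)
  qed simp
  show ?thesis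
  proof (cases "0 \<le> Im y")
    case True
    with half_disc[of \<i> a] roots(1) le_reflected[of a] show ?thesis
      by (force simp: inner_complex_def)
  next
    case False
    with half_disc[of "- \<i>" "cnj \<circ> a"] roots(1) le_reflected[of "cnj \<circ> a"] show ?thesis
      by (force simp: inner_complex_def)
  qed
qed

lemma reflected_dist_le:
  fixes y a :: complex and t :: real
  assumes "norm (y - t) \<le> norm (t - a) / 2"
  shows "reflected_dist y a \<le> 3 * norm (y - a)"
proof -
  have "norm (t - cnj a) = norm (t - a)"
    by (metis complex_cnj_diff complex_cnj_complex_of_real complex_mod_cnj)
  moreover have "norm (y - cnj a) \<le> norm (y - t) + norm (t - cnj a)"
    using norm_triangle_ineq[of "y - t" "t - cnj a"] by simp
  moreover have "norm (t - a) \<le> norm (y - t) + norm (y - a)"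
    using norm_triangle_ineq4[of "y - a" "y - t"] by simp
  ultimately show ?thesis using assms by (simp add: reflected_dist_def)
qed

lemma norm_quotient_prod_roots_le:
  fixes f v :: "complex \<Rightarrow> complex" and a :: "'i \<Rightarrow> complex" and y :: complex and t :: real
  assumes f_le: "norm (f y) \<le> C * (\<Prod>j\<in>I. reflected_dist y (a j))"
    and C_nonneg: "0 \<le> C" and v_ge: "0 < c" "c \<le> norm (v y)"
    and y_near: "\<And>j. j \<in> I \<Longrightarrow> norm (y - t) \<le> norm (t - a j) / 2"
    and nonzero: "(\<Prod>j\<in>I. y - a j) \<noteq> 0"
  shows "norm (f y / (v y * (\<Prod>j\<in>I. y - a j))) \<le> C * 3 ^ card I / c"
proof -
  have "(\<Prod>j\<in>I. reflected_dist y (a j)) \<le> (\<Prod>j\<in>I. 3 * norm (y - a j))"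
    using reflected_dist_le[OF y_near] by (intro prod_mono) (auto simp: reflected_dist_def le_max_iff_disj)
  then have "norm (f y) \<le> C * (3 ^ card I * norm (\<Prod>j\<in>I. y - a j))"
    using f_le mult_left_mono[OF _ C_nonneg] by (fastforce simp: prod.distrib prod_norm)
  also have "\<dots> \<le> C * 3 ^ card I / c * norm (v y * (\<Prod>j\<in>I. y - a j))"
    using v_ge C_nonneg by (simp add: norm_mult field_simps) (intro mult_left_mono mult_right_mono; simp)
  finally have "norm (f y) \<le> C * 3 ^ card I / c * norm (v y * (\<Prod>j\<in>I. y - a j))" .
  moreover have "0 < norm (v y * (\<Prod>j\<in>I. y - a j))" using nonzero v_ge by auto
  ultimately show ?thesis by (simp add: norm_divide pos_divide_le_eq)
qed

lemma ex_radius_harmonic: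
  fixes \<delta> :: "'i \<Rightarrow> real"
  assumes finite_I: "finite I" and \<rho>_pos: "0 < \<rho>" and \<delta>_pos: "\<And>j. j \<in> I \<Longrightarrow> 0 < \<delta> j"
  obtains d where "0 < d" "d \<le> \<rho>" "\<And>j. j \<in> I \<Longrightarrow> d \<le> \<delta> j" "1 / d = 1 / \<rho> + (\<Sum>j\<in>I. 1 / \<delta> j)"
proof
  let ?\<Sigma> = "1 / \<rho> + (\<Sum>j\<in>I. 1 / \<delta> j)"
  have sum_inverse_nonneg: "0 \<le> (\<Sum>j\<in>I. 1 / \<delta> j)" using \<delta>_pos by (simp add: sum_nonneg less_imp_le)
  then show harmonic_pos: "0 < 1 / ?\<Sigma>" using \<rho>_pos by (simp add: add_pos_nonneg)
  have "1 / ?\<Sigma> \<le> 1 / (1 / x)" if "0 < x" "1 / x \<le> ?\<Sigma>" for x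
    using that harmonic_pos by (intro divide_left_mono) (auto simp: zero_less_mult_iff)
  moreover have "1 / \<rho> \<le> ?\<Sigma>" using sum_inverse_nonneg by simp
  moreover have "1 / \<delta> j \<le> ?\<Sigma>" if "j \<in> I" for j
    using member_le_sum[OF that, of "\<lambda>j. 1 / \<delta> j"] finite_I \<rho>_pos \<delta>_pos
    by (simp add: less_imp_le add_increasing)
  ultimately show "1 / ?\<Sigma> \<le> \<rho>" "\<And>j. j \<in> I \<Longrightarrow> 1 / ?\<Sigma> \<le> \<delta> j" using \<rho>_pos \<delta>_pos by auto
qed simp

lemma norm_deriv_quotient_prod_roots_le:
  fixes f v :: "complex \<Rightarrow> complex" and a :: "'i \<Rightarrow> complex" and t :: real
  assumes f_hol: "f holomorphic_on cball 0 r" and v_hol: "v holomorphic_on cball 0 r"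
    and finite_I: "finite I" and C_nonneg: "0 \<le> C" and r_pos: "0 < r"
    and f_le: "\<And>y. norm y \<le> r \<Longrightarrow>
      norm (f y) \<le> C * (\<Prod>j\<in>I. reflected_dist y (a j))"
    and v_ge: "0 < c" "\<And>y. norm y \<le> r \<Longrightarrow> c \<le> norm (v y)"
    and t: "\<bar>t\<bar> \<le> r / 2" "\<And>j. j \<in> I \<Longrightarrow> t \<noteq> a j"
  shows "norm (deriv (\<lambda>y. f y / (v y * (\<Prod>j\<in>I. y - a j))) t)
    \<le> C * 3 ^ card I / c * (2 / r + (\<Sum>j\<in>I. 2 / norm (t - a j)))"
proof -
  let ?g = "\<lambda>y. f y / (v y * (\<Prod>j\<in>I. y - a j))"
  obtain d where d_bounds: "0 < d" "d \<le> r / 2" and d_le: "\<And>j. j \<in> I \<Longrightarrow> d \<le> norm (t - a j) / 2"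
    and inverse_d: "1 / d = 1 / (r / 2) + (\<Sum>j\<in>I. 1 / (norm (t - a j) / 2))"
    using ex_radius_harmonic[OF finite_I, of "r / 2" "\<lambda>j. norm (t - a j) / 2"] r_pos t(2) by auto
  have in_disc: "norm y \<le> r" if "norm (y - t) \<le> d" for y :: complex
    using that t(1) d_bounds(2) norm_triangle_ineq[of "y - t" "of_real t"] by simp
  have nonzero: "(\<Prod>j\<in>I. y - a j) \<noteq> 0" if "norm (y - t) \<le> d" for y :: complex
    using that d_bounds(1) d_le finite_I by (force simp: norm_minus_commute)
  have disc_subset: "cball (complex_of_real t) d \<subseteq> cball 0 r"
    using in_disc by (auto simp: dist_norm norm_minus_commute)
  have quotient_hol: "?g holomorphic_on cball (of_real t) d"
    using nonzero in_disc v_ge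
    by (intro holomorphic_intros holomorphic_on_subset[OF f_hol disc_subset]
        holomorphic_on_subset[OF v_hol disc_subset])
       (force simp: dist_norm norm_minus_commute)
  have "norm ((deriv ^^ 1) ?g t) \<le> fact 1 * (C * 3 ^ card I / c) / d ^ 1"
  proof (rule Cauchy_inequality)
    show "?g holomorphic_on ball (of_real t) d"
      using quotient_hol by (rule holomorphic_on_subset) auto
    show "continuous_on (cball (of_real t) d) ?g"
      using quotient_hol by (rule holomorphic_on_imp_continuous_on)
    fix y assume "norm (complex_of_real t - y) = d"
    then have y_near: "norm (y - t) \<le> d" by (simp add: norm_minus_commute)
    show "norm (?g y) \<le> C * 3 ^ card I / c"
      using f_le[OF in_disc[OF y_near]] C_nonneg v_ge(1) v_ge(2)[OF in_disc[OF y_near]]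
        order_trans[OF y_near d_le] nonzero[OF y_near]
      by (rule norm_quotient_prod_roots_le)
  qed (rule d_bounds(1))
  then have "norm (deriv ?g t) \<le> C * 3 ^ card I / c * (1 / d)" by simp
  then show ?thesis by (simp add: inverse_d)
qed

lemma norm_deriv_quotient_lower_roots_le:
  fixes f v :: "complex \<Rightarrow> complex" and a :: "'i \<Rightarrow> complex" and t :: real
  assumes f_hol: "f holomorphic_on cball 0 r" and v_hol: "v holomorphic_on cball 0 r"
    and finite_I: "finite I" and C_nonneg: "0 \<le> C" and r_pos: "0 < r"
    and roots: "\<And>j. j \<in> I \<Longrightarrow> Im (a j) < 0" "\<And>j. j \<in> I \<Longrightarrow> norm (a j) \<le> r / 2"
    and real: "\<And>t::real. \<bar>t\<bar> \<le> r \<Longrightarrow> norm (f t) \<le> C * (\<Prod>j\<in>I. norm (t - a j))"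
    and circle: "\<And>y. norm y = r \<Longrightarrow> norm (f y) \<le> D"
    and v_ge: "0 < c" "\<And>y. norm y \<le> r \<Longrightarrow> c \<le> norm (v y)"
    and t_small: "\<bar>t\<bar> \<le> r / 2"
  shows "norm (deriv (\<lambda>y. f y / (v y * (\<Prod>j\<in>I. y - a j))) t)
    \<le> max C (D / (r / 2) ^ card I) * 3 ^ card I / c * (2 / r + (\<Sum>j\<in>I. 2 / norm (t - a j)))"
proof (rule norm_deriv_quotient_prod_roots_le[OF f_hol v_hol finite_I _ r_pos _ v_ge t_small])
  let ?C = "max C (D / (r / 2) ^ card I)"
  show max_nonneg: "0 \<le> ?C" using C_nonneg by simp
  show "norm (f y) \<le> ?C * (\<Prod>j\<in>I. reflected_dist y (a j))" if "norm y \<le> r" for y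
  proof (rule norm_le_prod_reflected_dist[OF f_hol finite_I max_nonneg roots _ _ that])
    show "norm (f s) \<le> ?C * (\<Prod>j\<in>I. norm (s - a j))" if "\<bar>s\<bar> \<le> r" for s :: real
      using real[OF that] by (rule order_trans) (simp add: mult_right_mono prod_nonneg)
    have "D \<le> ?C * (r / 2) ^ card I"
      using r_pos by (simp add: pos_divide_le_eq[symmetric])
    then show "norm (f w) \<le> ?C * (r / 2) ^ card I" if "norm w = r" for w
      using circle[OF that] by simp
  qed
  show "t \<noteq> a j" if "j \<in> I" for j
    using roots(1)[OF that] by (metis Im_complex_of_real less_irrefl)
qed

subsection \<open>Convergent power series near the origin\<close>

lemma eventually_nhds_Pair_cball:
  fixes x0 :: "'a::metric_space" and y0 :: "'b::metric_space"
  assumes "\<forall>\<^sub>F z in nhds (x0, y0). Pr z"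
  shows "\<forall>\<^sub>F r in at_right 0. \<forall>x\<in>cball x0 r. \<forall>y\<in>cball y0 r. Pr (x, y)"
proof -
  obtain A B where ev_A: "\<forall>\<^sub>F x in nhds x0. A x" and ev_B: "\<forall>\<^sub>F y in nhds y0. B y"
    and AB: "\<And>x y. A x \<Longrightarrow> B y \<Longrightarrow> Pr (x, y)"
    using assms unfolding nhds_prod eventually_prod_filter by auto
  obtain e1 e2 where "e1 > 0" "\<And>x. dist x x0 < e1 \<Longrightarrow> A x" "e2 > 0" "\<And>y. dist y y0 < e2 \<Longrightarrow> B y"
    using ev_A ev_B unfolding eventually_nhds_metric by auto
  then show ?thesis
    unfolding eventually_at_right_field
    by (intro exI[of _ "min e1 e2"]) (auto simp: dist_commute intro!: AB)
qed

lemma isCont_imp_tendsto_nhds: "isCont f x \<Longrightarrow> (f \<longlongrightarrow> f x) (nhds x)"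
  by (simp add: isCont_def tendsto_at_iff_tendsto_nhds)

lemma eventually_nhds_compose_isCont:
  assumes "\<forall>\<^sub>F w in nhds y. Pr w" "isCont f x" "f x = y"
  shows "\<forall>\<^sub>F z in nhds x. Pr (f z)"
  using eventually_compose_filterlim[OF assms(1)] isCont_imp_tendsto_nhds[OF assms(2)] assms(3) by simp

lemma conv2_uniform_limit:
  assumes "conv2 F"
  obtains r a where "0 < r"
    "uniform_limit (cball 0 r \<times> cball 0 r) (\<lambda>X z. \<Sum>(i, j)\<in>X. a (i, j) * fst z ^ i * snd z ^ j)
      (\<lambda>z. F (fst z) (snd z)) (finite_subsets_at_top UNIV)"
proof -
  obtain R a where R_pos: "0 < R" and series: "\<forall>x y. norm x < R \<longrightarrow> norm y < R \<longrightarrow>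
      ((\<lambda>(i, j). a (i, j) * x ^ i * y ^ j) has_sum F x y) UNIV"
    using assms unfolding conv2_def by (elim exE conjE) (rule that)
  define r where "r = R / 2"
  have r_bounds: "0 < r" "r < R" using R_pos by (auto simp: r_def)
  have "(\<lambda>(i, j). a (i, j) * complex_of_real r ^ i * complex_of_real r ^ j) summable_on UNIV"
    using series[rule_format, of "of_real r" "of_real r"] r_bounds by (auto simp: summable_on_def)
  then have majorant: "(\<lambda>p. norm (case p of (i, j) \<Rightarrow>
      a (i, j) * complex_of_real r ^ i * complex_of_real r ^ j)) summable_on UNIV"
    by (simp add: summable_on_iff_abs_summable_on_complex)
  have "uniform_limit (cball 0 r \<times> cball 0 r) (\<lambda>X z. \<Sum>(i, j)\<in>X. a (i, j) * fst z ^ i * snd z ^ j)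
      (\<lambda>z. F (fst z) (snd z)) (finite_subsets_at_top UNIV)"
  proof (rule Weierstrass_m_test_general'[OF _ _ majorant])
    fix p and z :: "complex \<times> complex" assume z_in: "z \<in> cball 0 r \<times> cball 0 r"
    show "norm (case p of (i, j) \<Rightarrow> a (i, j) * fst z ^ i * snd z ^ j)
        \<le> norm (case p of (i, j) \<Rightarrow> a (i, j) * complex_of_real r ^ i * complex_of_real r ^ j)"
      using z_in r_bounds by (cases p) (auto simp: norm_mult norm_power intro!: mult_mono power_mono)
  next
    fix z :: "complex \<times> complex" assume "z \<in> cball 0 r \<times> cball 0 r"
    then show "((\<lambda>(i, j). a (i, j) * fst z ^ i * snd z ^ j) has_sum F (fst z) (snd z)) UNIV"
      using r_bounds by (intro series[rule_format]) auto
  qed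
  with r_bounds(1) show ?thesis by (rule that)
qed

lemma conv2_eventually_isCont:
  assumes "conv2 F"
  shows "\<forall>\<^sub>F z in nhds (0, 0). isCont (\<lambda>z. F (fst z) (snd z)) z"
proof -
  obtain r a where r_pos: "0 < r" and limit: "uniform_limit (cball 0 r \<times> cball 0 r)
      (\<lambda>X z. \<Sum>(i, j)\<in>X. a (i, j) * fst z ^ i * snd z ^ j) (\<lambda>z. F (fst z) (snd z))
      (finite_subsets_at_top UNIV)"
    by (rule conv2_uniform_limit[OF assms])
  have "continuous_on (cball 0 r \<times> cball 0 r) (\<lambda>z. F (fst z) (snd z))"
    by (rule uniform_limit_theorem[OF always_eventually limit])
       (auto simp: case_prod_unfold intro!: continuous_intros)
  then have "isCont (\<lambda>z. F (fst z) (snd z)) z" if "z \<in> ball 0 r \<times> ball 0 r" for z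
    using that by (auto intro: continuous_on_interior simp: interior_Times)
  then show ?thesis
    using r_pos by (auto simp: eventually_nhds intro!: exI[of _ "ball 0 r \<times> ball 0 r"] open_Times)
qed

lemma conv2_eventually_differentiable_snd:
  assumes "conv2 F"
  shows "\<forall>\<^sub>F z in nhds (0, 0). F (fst z) field_differentiable at (snd z)"
proof -
  obtain r a where r_pos: "0 < r" and limit: "uniform_limit (cball 0 r \<times> cball 0 r)
      (\<lambda>X z. \<Sum>(i, j)\<in>X. a (i, j) * fst z ^ i * snd z ^ j) (\<lambda>z. F (fst z) (snd z))
      (finite_subsets_at_top UNIV)"
    by (rule conv2_uniform_limit[OF assms])
  have "F x holomorphic_on ball 0 r" if "norm x < r" for x
  proof (rule holomorphic_uniform_limit)
    show "uniform_limit (cball 0 r) (\<lambda>X y. \<Sum>(i, j)\<in>X. a (i, j) * x ^ i * y ^ j) (F x)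
        (finite_subsets_at_top UNIV)"
      using uniform_limit_compose'[OF limit, of "Pair x" "cball 0 r"] that by auto
    show "\<forall>\<^sub>F X in finite_subsets_at_top UNIV.
        continuous_on (cball 0 r) (\<lambda>y. \<Sum>(i, j)\<in>X. a (i, j) * x ^ i * y ^ j) \<and>
        (\<lambda>y. \<Sum>(i, j)\<in>X. a (i, j) * x ^ i * y ^ j) holomorphic_on ball 0 r"
      unfolding case_prod_unfold by (intro always_eventually allI conjI continuous_intros holomorphic_intros)
  qed simp
  then have "F (fst z) field_differentiable at (snd z)" if "z \<in> ball 0 r \<times> ball 0 r" for z
    using that by (intro holomorphic_on_imp_differentiable_at[of _ "ball 0 r"]) auto
  then show ?thesis
    using r_pos by (auto simp: eventually_nhds intro!: exI[of _ "ball 0 r \<times> ball 0 r"] open_Times)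
qed

lemma conv2_tendsto:
  assumes "conv2 F"
  shows "((\<lambda>z. F (fst z) (snd z)) \<longlongrightarrow> F 0 0) (nhds (0, 0))"
  using isCont_imp_tendsto_nhds[OF eventually_nhds_x_imp_x[OF conv2_eventually_isCont[OF assms]]] by simp

lemma conv2_eventually_polydisc:
  assumes F_conv: "conv2 F" and \<epsilon>_pos: "0 < \<epsilon>"
  shows "\<forall>\<^sub>F r in at_right 0. \<forall>x\<in>cball 0 r. F x holomorphic_on cball 0 r \<and>
    (\<forall>y\<in>cball 0 r. dist (F x y) (F 0 0) < \<epsilon>)"
proof -
  have "\<forall>\<^sub>F z in nhds (0, 0). F (fst z) field_differentiable at (snd z) \<and>
      dist (F (fst z) (snd z)) (F 0 0) < \<epsilon>"
    using conv2_eventually_differentiable_snd[OF F_conv] tendstoD[OF conv2_tendsto[OF F_conv] \<epsilon>_pos]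
    by (rule eventually_conj)
  from eventually_nhds_Pair_cball[OF this] show ?thesis
    by eventually_elim (auto simp: holomorphic_on_def intro: field_differentiable_at_within)
qed

lemma eventually_isCont_restrR2:
  assumes "conv2 F"
  shows "\<forall>\<^sub>F z in nhds (0, 0). isCont (restrR2 F) z"
proof -
  have "\<forall>\<^sub>F z in nhds (0, 0). isCont (\<lambda>z. F (fst z) (snd z)) (of_real (fst z), of_real (snd z))"
    by (rule eventually_nhds_compose_isCont[OF conv2_eventually_isCont[OF assms]])
       (auto intro!: continuous_intros)
  then show ?thesis
  proof eventually_elim
    case (elim z)
    have "isCont (\<lambda>z. (complex_of_real (fst z), complex_of_real (snd z))) z"
      by (intro continuous_intros)
    from isCont_o2[OF this elim] show ?case by (simp add: restrR2_def[abs_def])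
  qed
qed

lemma restrR2_tendsto:
  assumes "conv2 F"
  shows "(restrR2 F \<longlongrightarrow> F 0 0) (nhds (0, 0))"
  using isCont_imp_tendsto_nhds[OF eventually_nhds_x_imp_x[OF eventually_isCont_restrR2[OF assms]]]
  by (simp add: restrR2_def[of F "(0, 0)"])

lemma conv1_isCont:
  assumes "conv1 f"
  shows "isCont f 0"
proof -
  obtain r a where r_pos: "0 < r" and sums: "\<And>x. norm x < r \<Longrightarrow> (\<lambda>i. a i * x ^ i) sums f x"
    using assms has_sum_imp_sums unfolding conv1_def by metis
  have "isCont (\<lambda>x. \<Sum>i. a i * x ^ i) 0"
    by (rule isCont_powser[of _ "of_real (r / 2)"]) (use r_pos in \<open>auto intro!: sums_summable sums\<close>)
  moreover have "\<forall>\<^sub>F x in nhds 0. f x = (\<Sum>i. a i * x ^ i)"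
    using eventually_nhds_in_open[of "ball 0 r" "0::complex"] r_pos
    by (auto elim!: eventually_mono dest!: sums simp: sums_iff)
  ultimately show ?thesis using isCont_cong[of f "\<lambda>x. \<Sum>i. a i * x ^ i" 0] by simp
qed

subsection \<open>Root branches\<close>

lemma real_root_branch:
  assumes "k \<ge> 1"
  obtains \<tau> :: "real \<Rightarrow> complex" where "\<And>x. \<tau> x ^ k = of_real x" "\<tau> 0 = 0" "isCont \<tau> 0"
proof -
  define \<tau> where "\<tau> x = of_real (root k \<bar>x\<bar>) * (if x \<ge> 0 then 1 else cis (pi / real k))" for x
  have "cis (pi / real k) ^ k = cis pi" using assms by (simp add: Complex.DeMoivre)
  then have "\<tau> x ^ k = of_real x" for x
    using assms by (auto simp: \<tau>_def power_mult_distrib simp flip: of_real_power)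
  moreover have "\<tau> 0 = 0" by (simp add: \<tau>_def)
  moreover have "isCont \<tau> 0"
  proof -
    have norm_\<tau>: "norm (\<tau> x) = root k \<bar>x\<bar>" for x
      using assms by (simp add: \<tau>_def norm_mult real_root_ge_zero)
    have "((\<lambda>x. norm (\<tau> x)) \<longlongrightarrow> root k \<bar>0\<bar>) (at 0)"
      unfolding norm_\<tau> by (intro tendsto_intros)
    then have "(\<tau> \<longlongrightarrow> 0) (at 0)" by (simp add: tendsto_norm_zero_iff)
    with \<open>\<tau> 0 = 0\<close> show ?thesis by (simp add: isCont_def)
  qed
  ultimately show ?thesis by (rule that)
qed

lemma poly_map_poly_of_real:
  "poly (map_poly of_real q) (of_real x :: 'a::{real_algebra_1, comm_semiring_1}) = of_real (poly q x)"
  by (simp add: poly_altdef degree_map_poly coeff_map_poly)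

lemma norm_real_combination_lower_bounds:
  fixes w :: complex and s t :: real
  shows "\<bar>s\<bar> * \<bar>Im w\<bar> \<le> norm (s + t * w) * norm w"
    and "\<bar>t\<bar> * \<bar>Im w\<bar> \<le> norm (s + t * w)"
proof -
  have "\<bar>s\<bar> * \<bar>Im w\<bar> = \<bar>Im ((s + t * w) * cnj w)\<bar>"
    by (simp add: algebra_simps abs_mult)
  also have "\<dots> \<le> norm ((s + t * w) * cnj w)" by (rule abs_Im_le_cmod)
  finally show "\<bar>s\<bar> * \<bar>Im w\<bar> \<le> norm (s + t * w) * norm w" by (simp add: norm_mult)
  show "\<bar>t\<bar> * \<bar>Im w\<bar> \<le> norm (s + t * w)"
    using abs_Im_le_cmod[of "s + t * w"] by (simp add: abs_mult)
qed

definition root_branch :: "(real \<Rightarrow> real) \<Rightarrow> nat \<Rightarrow> (real \<Rightarrow> complex) \<Rightarrow> real \<Rightarrow> complex" where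
  "root_branch \<gamma> m \<phi> x = - of_real (\<gamma> x) - of_real (x ^ m) * \<phi> x"

lemma isCont_root_branch:
  assumes "isCont \<gamma> x" "isCont \<phi> x"
  shows "isCont (root_branch \<gamma> m \<phi>) x"
  unfolding root_branch_def[abs_def] using assms by (intro continuous_intros)

lemma eventually_Im_root_branch_neg:
  assumes \<phi>: "isCont \<phi> 0" "0 < Im (\<phi> 0)" and even_m: "even m"
  shows "\<forall>\<^sub>F x in nhds 0. x \<noteq> 0 \<longrightarrow> Im (root_branch \<gamma> m \<phi> x) < 0"
proof -
  from order_tendstoD(1)[OF tendsto_Im[OF isCont_imp_tendsto_nhds[OF \<phi>(1)]] \<phi>(2)] show ?thesis
  proof eventually_elim
    case (elim x)
    then show ?case using even_m by (auto simp: root_branch_def zero_less_power_eq)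
  qed
qed

lemma norm_diff_root_branch_ge:
  fixes x y :: real
  assumes \<mu>_le: "\<mu> \<le> \<bar>Im (\<phi> x)\<bar>" and N_ge: "norm (\<phi> x) \<le> N" "1 \<le> N"
  shows "\<mu> / N * \<bar>y + \<gamma> x\<bar> \<le> norm (y - root_branch \<gamma> m \<phi> x)"
    and "\<mu> / N * \<bar>x\<bar> ^ m \<le> norm (y - root_branch \<gamma> m \<phi> x)"
proof -
  let ?w = "y - root_branch \<gamma> m \<phi> x"
  have w_eq: "?w = of_real (y + \<gamma> x) + of_real (x ^ m) * \<phi> x" by (simp add: root_branch_def)
  have "\<bar>y + \<gamma> x\<bar> * \<mu> \<le> \<bar>y + \<gamma> x\<bar> * \<bar>Im (\<phi> x)\<bar>"
    using \<mu>_le by (rule mult_left_mono) simp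
  also have "\<dots> \<le> norm ?w * norm (\<phi> x)"
    unfolding w_eq by (rule norm_real_combination_lower_bounds)
  also have "\<dots> \<le> norm ?w * N"
    using N_ge(1) by (rule mult_left_mono) simp
  finally show "\<mu> / N * \<bar>y + \<gamma> x\<bar> \<le> norm ?w"
    using N_ge by (simp add: field_simps)
  have "\<mu> * 1 \<le> \<bar>Im (\<phi> x)\<bar> * N"
    using \<mu>_le N_ge by (intro mult_mono) auto
  then have "\<mu> / N * \<bar>x\<bar> ^ m \<le> \<bar>Im (\<phi> x)\<bar> * \<bar>x\<bar> ^ m"
    using N_ge by (intro mult_right_mono) (auto simp: divide_le_eq)
  also have "\<dots> \<le> norm ?w"
    using norm_real_combination_lower_bounds(2)[of "x ^ m" "\<phi> x" "y + \<gamma> x"]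
    by (simp add: w_eq power_abs mult.commute)
  finally show "\<mu> / N * \<bar>x\<bar> ^ m \<le> norm ?w" .
qed

lemma eventually_norm_diff_root_branch_ge:
  assumes \<phi>: "isCont \<phi> 0" "Im (\<phi> 0) \<noteq> 0"
  shows "\<exists>c>0. \<forall>\<^sub>F z in nhds (0, y\<^sub>0).
    c * \<bar>snd z + \<gamma> (fst z)\<bar> \<le> norm (of_real (snd z) - root_branch \<gamma> m \<phi> (fst z)) \<and>
    c * \<bar>fst z\<bar> ^ m \<le> norm (of_real (snd z) - root_branch \<gamma> m \<phi> (fst z))"
proof -
  define \<mu> where "\<mu> = \<bar>Im (\<phi> 0)\<bar> / 2"
  define N where "N = norm (\<phi> 0) + 1"
  have \<mu>_pos: "0 < \<mu>" using \<phi>(2) by (simp add: \<mu>_def)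
  have N_ge: "1 \<le> N" by (simp add: N_def)
  note \<phi>_tendsto = isCont_imp_tendsto_nhds[OF \<phi>(1)]
  have "\<forall>\<^sub>F x in nhds 0. \<mu> < \<bar>Im (\<phi> x)\<bar>"
    by (rule order_tendstoD(1)[OF tendsto_rabs[OF tendsto_Im[OF \<phi>_tendsto]]]) (use \<phi>(2) in \<open>simp add: \<mu>_def\<close>)
  moreover have "\<forall>\<^sub>F x in nhds 0. norm (\<phi> x) < N"
    by (rule order_tendstoD(2)[OF tendsto_norm[OF \<phi>_tendsto]]) (simp add: N_def)
  ultimately have "\<forall>\<^sub>F x in nhds 0. \<mu> < \<bar>Im (\<phi> x)\<bar> \<and> norm (\<phi> x) < N" by (rule eventually_conj)
  then have "\<forall>\<^sub>F z in nhds (0, y\<^sub>0). \<mu> < \<bar>Im (\<phi> (fst z))\<bar> \<and> norm (\<phi> (fst z)) < N"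
    by (rule eventually_nhds_compose_isCont) auto
  then have "\<forall>\<^sub>F z in nhds (0, y\<^sub>0).
      \<mu> / N * \<bar>snd z + \<gamma> (fst z)\<bar> \<le> norm (of_real (snd z) - root_branch \<gamma> m \<phi> (fst z)) \<and>
      \<mu> / N * \<bar>fst z\<bar> ^ m \<le> norm (of_real (snd z) - root_branch \<gamma> m \<phi> (fst z))"
    by eventually_elim (use N_ge in \<open>intro conjI norm_diff_root_branch_ge; simp\<close>)
  with \<mu>_pos N_ge show ?thesis by (intro exI[of _ "\<mu> / N"]) auto
qed

lemma zorder_mult_prod_diff:
  fixes g :: "complex \<Rightarrow> complex" and b :: "'i \<Rightarrow> complex"
  assumes g_unit: "g analytic_on {z}" "g z \<noteq> 0" and finite_I: "finite I"
  shows "zorder (\<lambda>y. g y * (\<Prod>j\<in>I. y - b j)) z = int (card {j \<in> I. b j = z})"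
proof -
  let ?J = "{j \<in> I. b j = z}" and ?h = "\<lambda>y. g y * (\<Prod>j\<in>{j \<in> I. b j \<noteq> z}. y - b j)"
  have "?h analytic_on {z}" using g_unit(1) by (intro analytic_intros)
  then obtain S where "open S" "z \<in> S" "?h holomorphic_on S"
    by (meson analytic_at)
  moreover have "?h z \<noteq> 0" using g_unit(2) finite_I by auto
  moreover have "g y * (\<Prod>j\<in>I. y - b j) = ?h y * (y - z) powi int (card ?J)" for y
  proof -
    have "(\<Prod>j\<in>I. y - b j) = (\<Prod>j\<in>?J. y - b j) * (\<Prod>j\<in>{j \<in> I. b j \<noteq> z}. y - b j)"
      using finite_I by (subst prod.union_disjoint[symmetric]) (auto intro!: prod.cong)
    moreover have "(\<Prod>j\<in>?J. y - b j) = (y - z) ^ card ?J" by simp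
    ultimately show ?thesis by simp
  qed
  ultimately show ?thesis by (rule zorder_eqI)
qed

subsection \<open>Measurability of partial derivatives and essential bounds\<close>

lemma difference_quotient_LIMSEQ:
  fixes g :: "real \<Rightarrow> 'a::real_normed_vector"
  assumes "(g has_vector_derivative D) (at y)"
  shows "(\<lambda>n. real (Suc n) *\<^sub>R (g (y + 1 / real (Suc n)) - g y)) \<longlonglongrightarrow> D"
proof -
  have "filterlim (\<lambda>n. 1 / real (Suc n)) (at 0) sequentially"
    using LIMSEQ_inverse_real_of_nat by (auto simp: filterlim_at inverse_eq_divide)
  moreover have "((\<lambda>h. norm (g (y + h) - g y - h *\<^sub>R D) / norm h) \<longlongrightarrow> 0) (at 0)"
    using assms by (simp add: has_vector_derivative_def has_derivative_at)
  ultimately have "(\<lambda>n. norm (g (y + 1 / real (Suc n)) - g y - (1 / real (Suc n)) *\<^sub>R D) /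
      norm (1 / real (Suc n))) \<longlonglongrightarrow> 0"
    by (rule filterlim_compose[rotated])
  moreover have "norm (g (y + 1 / real (Suc n)) - g y - (1 / real (Suc n)) *\<^sub>R D) / norm (1 / real (Suc n))
      = norm (real (Suc n) *\<^sub>R (g (y + 1 / real (Suc n)) - g y) - D)" for n
  proof -
    have "real (Suc n) *\<^sub>R (g (y + 1 / real (Suc n)) - g y) - D
        = real (Suc n) *\<^sub>R (g (y + 1 / real (Suc n)) - g y - (1 / real (Suc n)) *\<^sub>R D)"
      by (simp add: scaleR_diff_right del: of_nat_Suc)
    then show ?thesis by (simp del: of_nat_Suc)
  qed
  ultimately show ?thesis by (simp only: tendsto_norm_zero_iff LIM_zero_iff)
qed

lemma borel_measurable_directional_derivative:
  fixes f :: "'a::euclidean_space \<Rightarrow> 'b::{real_normed_vector, second_countable_topology}"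
  assumes open_S: "open S" and f_cont: "continuous_on S f"
    and deriv: "\<And>z. z \<in> S \<Longrightarrow> ((\<lambda>t. f (z + t *\<^sub>R v)) has_vector_derivative f' z) (at 0)"
  shows "f' \<in> borel_measurable (lebesgue_on S)"
proof (rule borel_measurable_LIMSEQ_metric)
  define F where "F z = indicator S z *\<^sub>R f z" for z
  define h where "h n z = real (Suc n) *\<^sub>R (F (z + (1 / real (Suc n)) *\<^sub>R v) - F z)" for n z
  have [measurable]: "F \<in> borel_measurable borel"
    unfolding F_def using open_S f_cont by (intro borel_measurable_continuous_on_indicator) auto
  show "h n \<in> borel_measurable (lebesgue_on S)" for n
    unfolding h_def by (intro measurable_restrict_space1 measurable_completion) measurable
  fix z assume "z \<in> space (lebesgue_on S)"
  then have z_in: "z \<in> S" by (simp add: space_restrict_space)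
  have "(\<lambda>n. z + (1 / real (Suc n)) *\<^sub>R v) \<longlonglongrightarrow> z + 0 *\<^sub>R v"
    using LIMSEQ_inverse_real_of_nat by (intro tendsto_intros) (simp add: inverse_eq_divide)
  then have "\<forall>\<^sub>F n in sequentially. z + (1 / real (Suc n)) *\<^sub>R v \<in> S"
    using z_in open_S by (intro topological_tendstoD) auto
  then have "\<forall>\<^sub>F n in sequentially.
      real (Suc n) *\<^sub>R (f (z + (0 + 1 / real (Suc n)) *\<^sub>R v) - f (z + 0 *\<^sub>R v)) = h n z"
    by eventually_elim (use z_in in \<open>simp add: h_def F_def\<close>)
  with difference_quotient_LIMSEQ[OF deriv[OF z_in]] show "(\<lambda>n. h n z) \<longlonglongrightarrow> f' z"
    by (rule Lim_transform_eventually)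
qed

lemma borel_measurable_dy:
  assumes open_S: "open S" and f_cont: "continuous_on S f"
    and diff: "\<And>z. z \<in> S \<Longrightarrow> (\<lambda>t. f (fst z, t)) differentiable at (snd z)"
  shows "dy f \<in> borel_measurable (lebesgue_on S)"
proof (rule borel_measurable_directional_derivative[OF open_S f_cont, of "(0, 1)"])
  fix z assume "z \<in> S"
  then have "((\<lambda>t. f (fst z, t)) has_vector_derivative dy f z) (at (snd z + 0))"
    using diff by (simp add: dy_def vector_derivative_works)
  moreover have "((\<lambda>t. snd z + t) has_vector_derivative 1) (at 0)"
    by (auto intro!: derivative_eq_intros)
  ultimately have "((\<lambda>t. f (fst z, t)) \<circ> (\<lambda>t. snd z + t) has_vector_derivative 1 *\<^sub>R dy f z) (at 0)"
    by (intro vector_diff_chain_at)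
  then show "((\<lambda>t. f (z + t *\<^sub>R (0, 1))) has_vector_derivative dy f z) (at 0)"
    by (cases z) (simp add: o_def)
qed

lemma AE_lebesgue_on_le_imp_le:
  fixes f g :: "'a::euclidean_space \<Rightarrow> real"
  assumes open_U: "open U" and f_cont: "continuous_on U f" and g_cont: "continuous_on U g"
    and AE_le: "AE z in lebesgue_on U. f z \<le> g z" and z_in: "z \<in> U"
  shows "f z \<le> g z"
proof (rule ccontr)
  assume less: "\<not> f z \<le> g z"
  define N where "N = U \<inter> (\<lambda>z. f z - g z) -` {0<..}"
  have "open N" unfolding N_def
    using open_U f_cont g_cont by (intro continuous_open_preimage continuous_intros) auto
  moreover have "AE z in lebesgue. z \<notin> N"
    using AE_le open_U by (subst (asm) AE_restrict_space_iff) (auto simp: N_def elim!: eventually_mono)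
  then have "negligible N"
    using \<open>open N\<close> by (simp add: negligible_iff_null_sets AE_iff_null_sets)
  ultimately have "N = {}" using open_not_negligible by blast
  with z_in less show False by (auto simp: N_def)
qed

lemma Linf_loc_quotient_imp_norm_le:
  fixes f g :: "real \<times> real \<Rightarrow> complex"
  assumes bounded: "Linf_loc (\<lambda>z. f z / g z)"
    and f_cont: "\<forall>\<^sub>F z in nhds (0, 0). isCont f z" and g_cont: "\<forall>\<^sub>F z in nhds (0, 0). isCont g z"
    and nonzero: "\<forall>\<^sub>F z in nhds (0, 0). z \<noteq> (0, 0) \<longrightarrow> g z \<noteq> 0"
  obtains C where "0 \<le> C" "\<forall>\<^sub>F z in nhds (0, 0). norm (f z) \<le> C * norm (g z)"
proof -
  obtain U C where U_nhd: "open U" "(0, 0) \<in> U" and AE_le: "AE z in lebesgue_on U. norm (f z / g z) \<le> C"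
    using bounded unfolding Linf_loc_def by blast
  have "\<forall>\<^sub>F z in nhds (0, 0). z \<in> U" using U_nhd by (rule eventually_nhds_in_open)
  with f_cont g_cont nonzero
  have "\<forall>\<^sub>F z in nhds (0, 0). isCont f z \<and> isCont g z \<and> (z \<noteq> (0, 0) \<longrightarrow> g z \<noteq> 0) \<and> z \<in> U"
    by eventually_elim simp
  then obtain W where W_nhd: "open W" "(0, 0) \<in> W" "W \<subseteq> U"
    and cont_on_W: "continuous_on W f" "continuous_on W g"
    and g_nonzero: "\<And>z. z \<in> W \<Longrightarrow> z \<noteq> (0, 0) \<Longrightarrow> g z \<noteq> 0"
    unfolding eventually_nhds by (auto intro: continuous_at_imp_continuous_on)
  have "AE z in lebesgue. z \<in> U \<longrightarrow> norm (f z / g z) \<le> C"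
    using AE_le U_nhd by (subst (asm) AE_restrict_space_iff) auto
  moreover have "AE z in lebesgue. z \<noteq> (0 :: real, 0 :: real)"
    by (intro AE_completion AE_lborel_singleton)
  ultimately have "AE z in lebesgue. z \<in> W \<longrightarrow> norm (f z) \<le> \<bar>C\<bar> * norm (g z)"
  proof eventually_elim
    case (elim z)
    show ?case
    proof
      assume "z \<in> W"
      with elim W_nhd(3) g_nonzero[of z] have "norm (f z) \<le> C * norm (g z)"
        by (auto simp: norm_divide divide_le_eq)
      then show "norm (f z) \<le> \<bar>C\<bar> * norm (g z)"
        by (rule order_trans) (simp add: mult_right_mono)
    qed
  qed
  then have "AE z in lebesgue_on W. norm (f z) \<le> \<bar>C\<bar> * norm (g z)"
    using W_nhd(1) by (subst AE_restrict_space_iff) auto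
  then have "norm (f z) \<le> \<bar>C\<bar> * norm (g z)" if "z \<in> W" for z
    using that cont_on_W by (intro AE_lebesgue_on_le_imp_le[OF W_nhd(1)] continuous_intros)
  with W_nhd show thesis
    by (intro that[of "\<bar>C\<bar>"]) (auto simp: eventually_nhds)
qed

subsection \<open>Quotients with denominator vanishing along branches in the lower half-plane\<close>

locale lower_half_plane_branches =
  fixes P u :: "complex \<Rightarrow> complex \<Rightarrow> complex" and a :: "'i \<Rightarrow> real \<Rightarrow> complex" and I :: "'i set"
  assumes P_conv: "conv2 P" and u_conv: "conv2 u" and u_0: "u 0 0 \<noteq> 0"
    and finite_I: "finite I"
    and isCont_branch: "j \<in> I \<Longrightarrow> isCont (a j) 0"
    and Im_branch_neg: "j \<in> I \<Longrightarrow> \<forall>\<^sub>F x in nhds 0. x \<noteq> 0 \<longrightarrow> Im (a j x) < 0"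
    and factorization: "\<forall>\<^sub>F z in nhds (0 :: real, 0 :: complex).
      P (of_real (fst z)) (snd z) = u (of_real (fst z)) (snd z) * (\<Prod>j\<in>I. snd z - a j (fst z))"
    and zorder_P: "zorder (P 0) 0 = int (card I)"
begin

abbreviation quotient :: "(complex \<Rightarrow> complex \<Rightarrow> complex) \<Rightarrow> real \<times> real \<Rightarrow> complex" where
  "quotient Q \<equiv> (\<lambda>z. restrR2 Q z / restrR2 P z)"

lemma branch_0:
  assumes "j \<in> I"
  shows "a j 0 = 0"
proof -
  have "\<forall>\<^sub>F y in nhds 0. u 0 field_differentiable at y"
    using eventually_nhds_compose_isCont[OF conv2_eventually_differentiable_snd[OF u_conv],
        where f = "Pair 0" and x = 0]
    by (simp add: isCont_Pair)
  then have "u 0 analytic_on {0}"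
    unfolding eventually_nhds analytic_at
    by (metis field_differentiable_at_within holomorphic_on_def)
  then have "zorder (\<lambda>y. u 0 y * (\<Prod>j\<in>I. y - a j 0)) 0 = int (card {j \<in> I. a j 0 = 0})"
    using u_0 finite_I by (intro zorder_mult_prod_diff)
  moreover have "\<forall>\<^sub>F y in nhds 0. P 0 y = u 0 y * (\<Prod>j\<in>I. y - a j 0)"
    using eventually_nhds_compose_isCont[OF factorization, where f = "Pair 0" and x = 0]
    by (simp add: isCont_Pair)
  then have "zorder (P 0) 0 = zorder (\<lambda>y. u 0 y * (\<Prod>j\<in>I. y - a j 0)) 0"
    by (intro zorder_cong) (auto simp: eventually_at_filter elim: eventually_mono)
  ultimately have "card {j \<in> I. a j 0 = 0} = card I" using zorder_P by simp
  then have "{j \<in> I. a j 0 = 0} = I" using finite_I by (intro card_subset_eq) auto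
  with assms show ?thesis by blast
qed

lemma eventually_branch_small_Im_neg:
  assumes "0 < \<epsilon>"
  shows "\<forall>\<^sub>F x in nhds 0. \<forall>j\<in>I. norm (a j x) \<le> \<epsilon> \<and> (x \<noteq> 0 \<longrightarrow> Im (a j x) < 0)"
proof (intro eventually_ball_finite finite_I ballI eventually_conj Im_branch_neg)
  fix j assume j_in: "j \<in> I"
  have "(a j \<longlongrightarrow> 0) (nhds 0)"
    using isCont_imp_tendsto_nhds[OF isCont_branch[OF j_in]] branch_0[OF j_in] by simp
  from order_tendstoD(2)[OF tendsto_norm_zero[OF this] assms]
  show "\<forall>\<^sub>F x in nhds 0. norm (a j x) \<le> \<epsilon>" by eventually_elim simp
qed

lemma eventually_restrR2_factorization:
  "\<forall>\<^sub>F z in nhds (0, 0). restrR2 P z = restrR2 u z * (\<Prod>j\<in>I. of_real (snd z) - a j (fst z))"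
  using eventually_nhds_compose_isCont[OF factorization,
      where f = "\<lambda>z. (fst z, of_real (snd z))" and x = "(0, 0)"]
  by (simp add: restrR2_def continuous_intros)

lemma eventually_restrR2_nonzero: "\<forall>\<^sub>F z in nhds (0, 0). z \<noteq> (0, 0) \<longrightarrow> restrR2 P z \<noteq> 0"
proof -
  have "\<forall>\<^sub>F z in nhds (0, 0). restrR2 u z \<noteq> 0"
    using restrR2_tendsto[OF u_conv] u_0 by (rule tendsto_imp_eventually_ne)
  moreover have "\<forall>\<^sub>F z :: real \<times> real in nhds (0, 0). \<forall>j\<in>I. fst z \<noteq> 0 \<longrightarrow> Im (a j (fst z)) < 0"
    by (rule eventually_nhds_compose_isCont[where f = fst,
          OF eventually_mono[OF eventually_branch_small_Im_neg[of 1]]]) auto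
  ultimately show ?thesis using eventually_restrR2_factorization
  proof eventually_elim
    case (elim z)
    have "of_real (snd z) \<noteq> a j (fst z)" if "z \<noteq> (0, 0)" "j \<in> I" for j
    proof (cases "fst z = 0")
      case True
      with that branch_0 show ?thesis by (cases z) simp
    next
      case False
      with elim(2) that show ?thesis by (metis Im_complex_of_real less_irrefl)
    qed
    with elim finite_I show ?case by auto
  qed
qed

lemma eventually_numerator_le_prod:
  assumes "conv2 Q" "Linf_loc (quotient Q)"
  obtains C where "0 \<le> C"
    "\<forall>\<^sub>F z in nhds (0, 0). norm (restrR2 Q z) \<le> C * (\<Prod>j\<in>I. norm (of_real (snd z) - a j (fst z)))"
proof -
  obtain C where C_bound: "0 \<le> C" "\<forall>\<^sub>F z in nhds (0, 0). norm (restrR2 Q z) \<le> C * norm (restrR2 P z)"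
    using Linf_loc_quotient_imp_norm_le[OF assms(2) eventually_isCont_restrR2[OF assms(1)]
        eventually_isCont_restrR2[OF P_conv] eventually_restrR2_nonzero] .
  define E where "E = norm (u 0 0) + 1"
  have "\<forall>\<^sub>F z in nhds (0, 0). norm (restrR2 u z) < E"
    by (rule order_tendstoD(2)[OF tendsto_norm[OF restrR2_tendsto[OF u_conv]]]) (simp add: E_def)
  with C_bound(2) eventually_restrR2_factorization
  have "\<forall>\<^sub>F z in nhds (0, 0). norm (restrR2 Q z) \<le> C * E * (\<Prod>j\<in>I. norm (of_real (snd z) - a j (fst z)))"
  proof eventually_elim
    case (elim z)
    have "norm (restrR2 P z) \<le> E * (\<Prod>j\<in>I. norm (of_real (snd z) - a j (fst z)))"
      using elim(2,3) by (simp add: norm_mult prod_norm mult_right_mono)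
    with elim(1) C_bound(1) show ?case
      by (metis mult.assoc mult_left_mono order_trans)
  qed
  moreover have "0 \<le> C * E" using C_bound(1) by (simp add: E_def)
  ultimately show ?thesis using that by blast
qed

lemma eventually_quotient_has_vector_derivative:
  assumes Q_conv: "conv2 Q"
  shows "\<forall>\<^sub>F z in nhds (0, 0). z \<noteq> (0, 0) \<longrightarrow>
    ((\<lambda>t. quotient Q (fst z, t)) has_vector_derivative
      deriv (\<lambda>y. Q (of_real (fst z)) y / P (of_real (fst z)) y) (of_real (snd z))) (at (snd z))"
proof -
  have "\<forall>\<^sub>F z in nhds (0, 0). F (of_real (fst z)) field_differentiable at (of_real (snd z))"
    if "conv2 F" for F
    using eventually_nhds_compose_isCont[OF conv2_eventually_differentiable_snd[OF that],
        where f = "\<lambda>z. (of_real (fst z), of_real (snd z))" and x = "(0, 0)"]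
    by (simp add: continuous_intros)
  from this[OF Q_conv] this[OF P_conv] eventually_restrR2_nonzero show ?thesis
  proof eventually_elim
    case (elim z)
    show ?case
    proof
      assume "z \<noteq> (0, 0)"
      with elim have "(\<lambda>y. Q (of_real (fst z)) y / P (of_real (fst z)) y) field_differentiable
          at (of_real (snd z))"
        by (intro field_differentiable_divide) (auto simp: restrR2_def)
      from has_vector_derivative_real_field[OF this[unfolded DERIV_deriv_iff_field_differentiable[symmetric]]]
      show "((\<lambda>t. quotient Q (fst z, t)) has_vector_derivative
          deriv (\<lambda>y. Q (of_real (fst z)) y / P (of_real (fst z)) y) (of_real (snd z))) (at (snd z))"
        by (simp add: restrR2_def)
    qed
  qed
qed

definition factored_polydisc :: "(complex \<Rightarrow> complex \<Rightarrow> complex) \<Rightarrow> real \<Rightarrow> real \<Rightarrow> bool" where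
  "factored_polydisc Q C r \<longleftrightarrow> 0 < r \<and>
    (\<forall>x\<in>cball 0 r. Q x holomorphic_on cball 0 r \<and> (\<forall>y\<in>cball 0 r. dist (Q x y) (Q 0 0) < 1)) \<and>
    (\<forall>x\<in>cball 0 r. u x holomorphic_on cball 0 r \<and> (\<forall>y\<in>cball 0 r. dist (u x y) (u 0 0) < norm (u 0 0) / 2)) \<and>
    (\<forall>x\<in>cball 0 r. \<forall>y\<in>cball 0 r. P (of_real x) y = u (of_real x) y * (\<Prod>j\<in>I. y - a j x)) \<and>
    (\<forall>x\<in>cball 0 r. \<forall>y\<in>cball 0 r. norm (Q (of_real x) (of_real y)) \<le> C * (\<Prod>j\<in>I. norm (of_real y - a j x)))"

lemma ex_factored_polydisc:
  assumes Q_conv: "conv2 Q" and "Linf_loc (quotient Q)"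
  obtains C r where "0 \<le> C" "factored_polydisc Q C r"
proof -
  obtain C where C_bound: "0 \<le> C"
    "\<forall>\<^sub>F z in nhds (0, 0). norm (restrR2 Q z) \<le> C * (\<Prod>j\<in>I. norm (of_real (snd z) - a j (fst z)))"
    using assms by (rule eventually_numerator_le_prod)
  have "0 < norm (u 0 0) / 2" using u_0 by simp
  from conv2_eventually_polydisc[OF Q_conv zero_less_one] conv2_eventually_polydisc[OF u_conv this]
    eventually_nhds_Pair_cball[OF factorization] eventually_nhds_Pair_cball[OF C_bound(2)]
    eventually_at_right_less[of 0]
  have "\<forall>\<^sub>F r in at_right 0. factored_polydisc Q C r"
    by eventually_elim (simp add: factored_polydisc_def restrR2_def)
  from eventually_happens'[OF _ this] C_bound(1) show thesis using that by auto
qed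

lemma norm_deriv_quotient_slice_le:
  fixes x t :: real
  assumes polydisc: "factored_polydisc Q C r" and C_nonneg: "0 \<le> C"
    and x_small: "\<bar>x\<bar> \<le> r" and t_small: "\<bar>t\<bar> \<le> r / 2"
    and roots: "\<And>j. j \<in> I \<Longrightarrow> Im (a j x) < 0" "\<And>j. j \<in> I \<Longrightarrow> norm (a j x) \<le> r / 2"
  shows "norm (deriv (\<lambda>y. Q x y / P x y) t)
    \<le> max C ((norm (Q 0 0) + 1) / (r / 2) ^ card I) * 3 ^ card I / (norm (u 0 0) / 2) *
      (2 / r + (\<Sum>j\<in>I. 2 / norm (t - a j x)))"
proof -
  have r_pos: "0 < r" using polydisc by (simp add: factored_polydisc_def)
  have factored: "P x y = u x y * (\<Prod>j\<in>I. y - a j x)" if "norm y \<le> r" for y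
    using polydisc x_small that by (simp add: factored_polydisc_def)
  have "\<forall>\<^sub>F y in nhds (of_real t). Q x y / P x y = Q x y / (u x y * (\<Prod>j\<in>I. y - a j x))"
    using eventually_nhds_in_open[of "ball 0 r" "complex_of_real t"] t_small r_pos factored
    by (auto elim!: eventually_mono)
  then have "deriv (\<lambda>y. Q x y / P x y) t = deriv (\<lambda>y. Q x y / (u x y * (\<Prod>j\<in>I. y - a j x))) t"
    by (rule deriv_cong_ev) simp
  also have "norm \<dots> \<le> max C ((norm (Q 0 0) + 1) / (r / 2) ^ card I) * 3 ^ card I / (norm (u 0 0) / 2) *
      (2 / r + (\<Sum>j\<in>I. 2 / norm (t - a j x)))"
  proof (rule norm_deriv_quotient_lower_roots_le[OF _ _ finite_I C_nonneg r_pos roots _ _ _ _ t_small])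
    show "Q x holomorphic_on cball 0 r" "u x holomorphic_on cball 0 r"
      using polydisc x_small by (simp_all add: factored_polydisc_def)
    show "norm (Q x s) \<le> C * (\<Prod>j\<in>I. norm (s - a j x))" if "\<bar>s\<bar> \<le> r" for s :: real
      using polydisc x_small that by (simp add: factored_polydisc_def)
    show "norm (Q x y) \<le> norm (Q 0 0) + 1" if "norm y = r" for y
    proof -
      have "dist (Q x y) (Q 0 0) < 1"
        using polydisc x_small that by (simp add: factored_polydisc_def)
      then show ?thesis using norm_triangle_ineq2[of "Q x y" "Q 0 0"] by (simp add: dist_norm)
    qed
    show "norm (u 0 0) / 2 \<le> norm (u x y)" if "norm y \<le> r" for y
    proof -
      have "dist (u x y) (u 0 0) < norm (u 0 0) / 2"
        using polydisc x_small that by (simp add: factored_polydisc_def)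
      then show ?thesis using norm_triangle_ineq2[of "u 0 0" "u x y"]
        by (simp add: dist_norm norm_minus_commute)
    qed
    show "0 < norm (u 0 0) / 2" using u_0 by simp
  qed
  finally show ?thesis .
qed

lemma eventually_norm_dy_quotient_le:
  assumes Q_conv: "conv2 Q" and "Linf_loc (quotient Q)"
  obtains B where "0 \<le> B" "\<forall>\<^sub>F z in nhds (0, 0). fst z \<noteq> 0 \<longrightarrow>
    norm (dy (quotient Q) z)
      \<le> B * (1 + (\<Sum>j\<in>I. 1 / norm (of_real (snd z) - a j (fst z))))"
proof -
  obtain C r where C_nonneg: "0 \<le> C" and polydisc: "factored_polydisc Q C r"
    using assms by (rule ex_factored_polydisc)
  have r_pos: "0 < r" using polydisc by (simp add: factored_polydisc_def)
  define B where "B = max C ((norm (Q 0 0) + 1) / (r / 2) ^ card I) * 3 ^ card I / (norm (u 0 0) / 2)"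
  have B_nonneg: "0 \<le> B" using C_nonneg by (simp add: B_def le_max_iff_disj)
  have "\<forall>\<^sub>F z in nhds (0 :: real, 0 :: real). \<bar>fst z\<bar> \<le> r \<and> \<bar>snd z\<bar> \<le> r / 2"
    using r_pos by (auto simp: eventually_nhds intro!: exI[of _ "ball 0 r \<times> ball 0 (r / 2)"] open_Times)
  moreover have "\<forall>\<^sub>F z :: real \<times> real in nhds (0, 0). \<forall>j\<in>I. norm (a j (fst z)) \<le> r / 2 \<and>
      (fst z \<noteq> 0 \<longrightarrow> Im (a j (fst z)) < 0)"
    using r_pos
    by (intro eventually_nhds_compose_isCont[where f = fst,
          OF eventually_branch_small_Im_neg[of "r / 2"]]) auto
  moreover note eventually_quotient_has_vector_derivative[OF Q_conv]
  ultimately have "\<forall>\<^sub>F z in nhds (0, 0). fst z \<noteq> 0 \<longrightarrow>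
      norm (dy (quotient Q) z)
        \<le> B * (2 / r + 2) * (1 + (\<Sum>j\<in>I. 1 / norm (of_real (snd z) - a j (fst z))))"
  proof eventually_elim
    case (elim z)
    let ?\<Sigma> = "\<Sum>j\<in>I. 1 / norm (of_real (snd z) - a j (fst z))"
    show ?case
    proof
      assume "fst z \<noteq> 0"
      with elim have "dy (quotient Q) z
          = deriv (\<lambda>y. Q (of_real (fst z)) y / P (of_real (fst z)) y) (of_real (snd z))"
        unfolding dy_def by (intro vector_derivative_at) auto
      also have "norm \<dots> \<le> B * (2 / r + (\<Sum>j\<in>I. 2 / norm (of_real (snd z) - a j (fst z))))"
        using elim \<open>fst z \<noteq> 0\<close> unfolding B_def by (intro norm_deriv_quotient_slice_le polydisc C_nonneg) auto
      also have "\<dots> = B * (2 / r + 2 * ?\<Sigma>)"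
        by (simp add: sum_distrib_left)
      also have "\<dots> \<le> B * ((2 / r + 2) * (1 + ?\<Sigma>))"
        using B_nonneg r_pos by (intro mult_left_mono) (auto simp: algebra_simps sum_nonneg)
      finally show "norm (dy (quotient Q) z) \<le> B * (2 / r + 2) * (1 + ?\<Sigma>)"
        by (simp add: mult.assoc)
    qed
  qed
  moreover have "0 \<le> B * (2 / r + 2)" using B_nonneg r_pos by simp
  ultimately show thesis using that by blast
qed

lemma borel_measurable_dy_quotient:
  assumes Q_conv: "conv2 Q"
  obtains W where "open W" "(0, 0) \<in> W"
    "dy (quotient Q) \<in> borel_measurable (lebesgue_on W)"
proof -
  from eventually_isCont_restrR2[OF Q_conv] eventually_isCont_restrR2[OF P_conv]
    eventually_restrR2_nonzero eventually_quotient_has_vector_derivative[OF Q_conv]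
  have "\<forall>\<^sub>F z in nhds (0, 0). z \<noteq> (0, 0) \<longrightarrow>
      isCont (quotient Q) z \<and> (\<lambda>t. quotient Q (fst z, t)) differentiable at (snd z)"
    by eventually_elim (auto intro: differentiableI_vector)
  then obtain W where W_nhd: "open W" "(0, 0) \<in> W"
    and cont: "continuous_on (W - {(0, 0)}) (quotient Q)"
    and diff: "\<And>z. z \<in> W - {(0, 0)} \<Longrightarrow> (\<lambda>t. quotient Q (fst z, t)) differentiable at (snd z)"
    unfolding eventually_nhds by (auto intro!: continuous_at_imp_continuous_on)
  have "dy (quotient Q) \<in> borel_measurable (lebesgue_on W)"
  proof (rule measurable_restrict_countable)
    have "dy (quotient Q) \<in> borel_measurable (lebesgue_on (W - {(0, 0)}))"
      using W_nhd(1) cont diff by (intro borel_measurable_dy open_delete)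
    then show "dy (quotient Q) \<in> borel_measurable (restrict_space (lebesgue_on W) (- {(0, 0)}))"
      using W_nhd(1) by (subst restrict_restrict_space) (auto simp: Diff_eq)
    show "{z} \<in> sets (lebesgue_on W)" if "z \<in> {(0, 0)}" for z
      using that W_nhd by (auto simp: sets_restrict_space_iff)
  qed auto
  with W_nhd show thesis by (rule that)
qed

end

subsection \<open>Integrability of inverse distances to curves\<close>

lemma integrable_abs_powr_neg:
  fixes \<alpha> c :: real
  assumes "\<alpha> < 1"
  shows "integrable lborel (\<lambda>t. indicator {- c..c} t * \<bar>t\<bar> powr - \<alpha>)"
proof (cases "0 \<le> c")
  case True
  define f where "f t = indicator {0..c} t * t powr - \<alpha>" for t :: real
  have f_borel: "f \<in> borel_measurable borel" unfolding f_def by measurable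
  have "(\<lambda>t. t powr - \<alpha>) absolutely_integrable_on {0..c}"
    using assms True by (intro nonnegative_absolutely_integrable_1 integrable_on_powr_from_0) auto
  then have f_integrable: "integrable lborel f"
    using f_borel by (simp add: set_integrable_def integrable_completion f_def[abs_def])
  then have "integrable lborel (\<lambda>t. f (0 + (-1) * t))"
    by (rule lborel_integrable_real_affine) simp
  with f_integrable have "integrable lborel (\<lambda>t. f t + f (- t))" by simp
  then show ?thesis
    by (rule Bochner_Integration.integrable_bound) (auto simp: f_def indicator_def abs_if)
qed simp

lemma integrable_product_shear:
  fixes g h \<gamma> :: "real \<Rightarrow> real"
  assumes g_integrable: "integrable lborel g" and h_integrable: "integrable lborel h"
    and \<gamma>_borel: "\<gamma> \<in> borel_measurable borel"
  shows "integrable lborel (\<lambda>z. g (fst z) * h (snd z + \<gamma> (fst z)))"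
proof -
  have [measurable]: "g \<in> borel_measurable borel" "h \<in> borel_measurable borel"
    using borel_measurable_integrable[OF g_integrable] borel_measurable_integrable[OF h_integrable]
    by simp_all
  note \<gamma>_borel[measurable]
  have h_shift: "integrable lborel (\<lambda>y. h (y + c))" for c
    using lborel_integrable_real_affine[OF h_integrable, of 1 c] by (simp add: add.commute)
  have h_shift_norm: "(\<integral>y. norm (h (y + c)) \<partial>lborel) = (\<integral>y. norm (h y) \<partial>lborel)" for c
    using lborel_integral_real_affine[of 1 "\<lambda>y. norm (h y)" c] by (simp add: add.commute)
  have "integrable (lborel \<Otimes>\<^sub>M lborel) (\<lambda>z. g (fst z) * h (snd z + \<gamma> (fst z)))"
  proof (rule lborel_pair.Fubini_integrable)
    show "integrable lborel (\<lambda>x. \<integral>y. norm (g (fst (x, y)) * h (snd (x, y) + \<gamma> (fst (x, y)))) \<partial>lborel)"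
      using g_integrable by (simp add: norm_mult h_shift_norm del: real_norm_def)
    show "AE x in lborel. integrable lborel (\<lambda>y. g (fst (x, y)) * h (snd (x, y) + \<gamma> (fst (x, y))))"
      using h_shift by simp
  qed measurable
  then show ?thesis by (simp add: lborel_prod)
qed

definition integrable_on_squares :: "(real \<times> real \<Rightarrow> real) \<Rightarrow> bool" where
  "integrable_on_squares G \<longleftrightarrow> (\<forall>s. integrable (lebesgue_on (ball 0 s \<times> ball 0 s)) G)"

lemma integrable_on_squares_curve_powr_neg:
  fixes \<alpha> \<beta> :: real and \<gamma> :: "real \<Rightarrow> real"
  assumes \<alpha>_less: "\<alpha> < 1" and \<beta>_less: "\<beta> < 1" and \<gamma>_cont: "continuous_on UNIV \<gamma>"
  shows "integrable_on_squares (\<lambda>z. \<bar>snd z + \<gamma> (fst z)\<bar> powr - \<alpha> * \<bar>fst z\<bar> powr - \<beta>)"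
  unfolding integrable_on_squares_def
proof
  fix s
  let ?S = "ball 0 s \<times> ball 0 s :: (real \<times> real) set"
  have S_lebesgue: "?S \<in> sets lebesgue"
    by (intro lmeasurable_open fmeasurableD) (auto intro: open_Times bounded_Times)
  have "compact (\<gamma> ` cball 0 s)"
    by (intro compact_continuous_image continuous_on_subset[OF \<gamma>_cont]) auto
  then obtain b where \<gamma>_bound: "\<And>x. \<bar>x\<bar> \<le> s \<Longrightarrow> \<bar>\<gamma> x\<bar> \<le> b"
    using compact_imp_bounded bounded_iff by (metis image_eqI mem_cball_0 real_norm_def)
  define g where "g t = indicator {- s..s} t * \<bar>t\<bar> powr - \<beta>" for t :: real
  define h where "h t = indicator {- (s + b)..s + b} t * \<bar>t\<bar> powr - \<alpha>" for t :: real
  have "integrable lborel (\<lambda>z. g (fst z) * h (snd z + \<gamma> (fst z)))"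
    unfolding g_def h_def
    by (intro integrable_product_shear integrable_abs_powr_neg \<alpha>_less \<beta>_less
        borel_measurable_continuous_onI \<gamma>_cont)
  then have "integrable lebesgue (\<lambda>z. g (fst z) * h (snd z + \<gamma> (fst z)))"
    by (subst integrable_completion) (auto dest: borel_measurable_integrable)
  then have "integrable (lebesgue_on ?S) (\<lambda>z. g (fst z) * h (snd z + \<gamma> (fst z)))"
    using integrable_mult_indicator[OF S_lebesgue, of "\<lambda>z. g (fst z) * h (snd z + \<gamma> (fst z))"] S_lebesgue
    by (simp add: integrable_restrict_space)
  moreover have "g (fst z) * h (snd z + \<gamma> (fst z)) = \<bar>snd z + \<gamma> (fst z)\<bar> powr - \<alpha> * \<bar>fst z\<bar> powr - \<beta>"
    if "z \<in> ?S" for z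
  proof -
    have "\<bar>fst z\<bar> \<le> s" "\<bar>snd z + \<gamma> (fst z)\<bar> \<le> s + b"
      using that \<gamma>_bound[of "fst z"] by (auto simp: mem_Times_iff)
    then show ?thesis by (auto simp: g_def h_def indicator_def)
  qed
  ultimately show "integrable (lebesgue_on ?S) (\<lambda>z. \<bar>snd z + \<gamma> (fst z)\<bar> powr - \<alpha> * \<bar>fst z\<bar> powr - \<beta>)"
    by (subst (asm) Bochner_Integration.integrable_cong[OF refl]) (auto simp: space_restrict_space)
qed

lemma integrable_on_squares_cmult_one_plus_sum:
  fixes c :: real
  assumes "\<And>j. j \<in> I \<Longrightarrow> integrable_on_squares (G j)"
  shows "integrable_on_squares (\<lambda>z. c * (1 + (\<Sum>j\<in>I. G j z)))"
  unfolding integrable_on_squares_def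
proof
  fix s
  interpret finite_measure "lebesgue_on (ball 0 s \<times> ball 0 s :: (real \<times> real) set)"
    by (intro finite_measure_lebesgue_on lmeasurable_open bounded_Times open_Times) auto
  show "integrable (lebesgue_on (ball 0 s \<times> ball 0 s)) (\<lambda>z. c * (1 + (\<Sum>j\<in>I. G j z)))"
    using assms unfolding integrable_on_squares_def
    by (intro integrable_mult_right Bochner_Integration.integrable_add
        Bochner_Integration.integrable_sum integrable_const) auto
qed

lemma AE_lborel_off_axis_and_graphs:
  fixes \<gamma> :: "'i \<Rightarrow> real \<Rightarrow> real"
  assumes finite_I: "finite I" and \<gamma>_borel: "\<And>j. j \<in> I \<Longrightarrow> \<gamma> j \<in> borel_measurable borel"
  shows "AE z in lborel. fst z \<noteq> 0 \<and> (\<forall>j\<in>I. snd z \<noteq> \<gamma> j (fst z))"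
proof -
  have "AE z in lborel \<Otimes>\<^sub>M lborel. snd z \<noteq> \<gamma> j (fst z)" if "j \<in> I" for j
  proof (rule lborel_pair.AE_pair_measure)
    note \<gamma>_borel[OF that, measurable]
    show "{z \<in> space (lborel \<Otimes>\<^sub>M lborel). snd z \<noteq> \<gamma> j (fst z)} \<in> sets (lborel \<Otimes>\<^sub>M lborel)"
      by measurable
    have "AE y in lborel. y \<noteq> \<gamma> j x" for x by (rule AE_lborel_singleton)
    then show "AE x in lborel. AE y in lborel. snd (x, y) \<noteq> \<gamma> j (fst (x, y))" by simp
  qed
  then have "AE z in lborel. \<forall>j\<in>I. snd z \<noteq> \<gamma> j (fst z)"
    unfolding lborel_prod using finite_I by (intro AE_finite_allI)
  moreover have "AE z in (lborel :: (real \<times> real) measure). fst z \<noteq> 0"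
    using AE_lborel_inner_neq[of "(1, 0) :: real \<times> real" 0] by (simp add: Basis_prod_def inner_prod_def)
  ultimately show ?thesis by eventually_elim simp
qed

lemma powr_exponent_split:
  fixes m p :: real
  assumes "0 \<le> m" "1 \<le> p" "m * (p - 1) < 1"
  obtains \<alpha> where "0 \<le> \<alpha>" "\<alpha> < 1" "\<alpha> \<le> p" "m * (p - \<alpha>) < 1"
proof -
  define \<delta> where "\<delta> = (1 - m * (p - 1)) / (m + 1)"
  have "0 < \<delta>" using assms by (simp add: \<delta>_def)
  moreover have "\<delta> \<le> 1"
  proof -
    have "0 \<le> m * (p - 1)" using assms by simp
    then have "1 - m * (p - 1) \<le> m + 1" using assms(1) by linarith
    then show ?thesis using assms(1) by (simp add: \<delta>_def divide_le_eq)
  qed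
  moreover have "m * \<delta> < 1 - m * (p - 1)" using assms by (simp add: \<delta>_def field_simps)
  ultimately show thesis
    using assms(2) by (intro that[of "1 - \<delta>"]) (auto simp: algebra_simps)
qed

lemma powr_neg_le_interpolation:
  fixes c w X Y p \<alpha> :: real
  assumes "0 < c" "0 < X" "0 < Y" "c * X \<le> w" "c * Y \<le> w" "0 \<le> \<alpha>" "\<alpha> \<le> p"
  shows "w powr - p \<le> c powr - p * (X powr - \<alpha> * Y powr - (p - \<alpha>))"
proof -
  have "w powr - p = w powr - \<alpha> * w powr - (p - \<alpha>)" by (simp flip: powr_add)
  also have "\<dots> \<le> (c * X) powr - \<alpha> * (c * Y) powr - (p - \<alpha>)"
    using assms by (intro mult_mono powr_mono2') auto
  also have "\<dots> = (c powr - \<alpha> * c powr - (p - \<alpha>)) * (X powr - \<alpha> * Y powr - (p - \<alpha>))"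
    using assms by (simp add: powr_mult)
  also have "c powr - \<alpha> * c powr - (p - \<alpha>) = c powr - p" by (simp flip: powr_add)
  finally show ?thesis .
qed

lemma one_plus_sum_powr_le:
  fixes t :: "'i \<Rightarrow> real"
  assumes finite_I: "finite I" and t_nonneg: "\<And>j. j \<in> I \<Longrightarrow> 0 \<le> t j" and p_nonneg: "0 \<le> p"
  shows "(1 + (\<Sum>j\<in>I. t j)) powr p \<le> (1 + card I) powr p * (1 + (\<Sum>j\<in>I. t j powr p))"
proof -
  define \<mu> where "\<mu> = Max (insert 1 (t ` I))"
  have \<mu>_in: "\<mu> \<in> insert 1 (t ` I)" unfolding \<mu>_def using finite_I by (intro Max_in) auto
  have le_\<mu>: "1 \<le> \<mu>" "\<And>j. j \<in> I \<Longrightarrow> t j \<le> \<mu>" using finite_I by (auto simp: \<mu>_def)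
  have "1 + (\<Sum>j\<in>I. t j) \<le> (1 + card I) * \<mu>"
    using le_\<mu> sum_bounded_above[of I t \<mu>] by (simp add: algebra_simps)
  then have "(1 + (\<Sum>j\<in>I. t j)) powr p \<le> ((1 + card I) * \<mu>) powr p"
    using t_nonneg p_nonneg by (intro powr_mono2) (auto simp: sum_nonneg)
  also have "\<dots> = (1 + card I) powr p * \<mu> powr p" using le_\<mu> by (simp add: powr_mult)
  also have "\<mu> powr p \<le> 1 + (\<Sum>j\<in>I. t j powr p)"
    using \<mu>_in finite_I member_le_sum[of _ I "\<lambda>j. t j powr p"]
    by (auto simp: sum_nonneg intro: order_trans[of _ "\<Sum>j\<in>I. t j powr p"])
  finally show ?thesis by (simp add: mult_left_mono)
qed

text \<open>The splitting \<open>p = \<alpha> + (p - \<alpha>)\<close> with \<open>\<alpha> < 1\<close> and \<open>m (p - \<alpha>) < 1\<close> spends one lower bound on each part,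
  which decouples the variables.\<close>
lemma inverse_distance_powr_majorant:
  fixes \<delta> :: "real \<times> real \<Rightarrow> real" and \<gamma> :: "real \<Rightarrow> real" and m :: nat and p :: real
  assumes \<gamma>_cont: "continuous_on UNIV \<gamma>" and p_bounds: "1 \<le> p" "m * (p - 1) < 1" and c_pos: "0 < c"
    and \<delta>_ge: "\<forall>\<^sub>F z in nhds (0, 0). c * \<bar>snd z + \<gamma> (fst z)\<bar> \<le> \<delta> z \<and> c * \<bar>fst z\<bar> ^ m \<le> \<delta> z"
  obtains G where "integrable_on_squares G"
    "\<forall>\<^sub>F z in nhds (0, 0). fst z \<noteq> 0 \<and> snd z \<noteq> - \<gamma> (fst z) \<longrightarrow> 0 \<le> 1 / \<delta> z \<and> (1 / \<delta> z) powr p \<le> G z"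
proof -
  obtain \<alpha> where \<alpha>_bounds: "0 \<le> \<alpha>" "\<alpha> < 1" "\<alpha> \<le> p" "m * (p - \<alpha>) < 1"
    using powr_exponent_split[of m p] p_bounds by auto
  define G where "G z = c powr - p * (\<bar>snd z + \<gamma> (fst z)\<bar> powr - \<alpha> * \<bar>fst z\<bar> powr - (m * (p - \<alpha>)))" for z
  have "integrable_on_squares G"
    using integrable_on_squares_curve_powr_neg[OF \<alpha>_bounds(2,4) \<gamma>_cont]
    by (simp add: G_def[abs_def] integrable_on_squares_def)
  moreover have "\<forall>\<^sub>F z in nhds (0, 0). fst z \<noteq> 0 \<and> snd z \<noteq> - \<gamma> (fst z) \<longrightarrow> 0 \<le> 1 / \<delta> z \<and> (1 / \<delta> z) powr p \<le> G z"
    using \<delta>_ge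
  proof eventually_elim
    case (elim z)
    show ?case
    proof
      assume z_generic: "fst z \<noteq> 0 \<and> snd z \<noteq> - \<gamma> (fst z)"
      then have pos: "0 < \<bar>snd z + \<gamma> (fst z)\<bar>" "0 < \<bar>fst z\<bar> ^ m" by auto
      then have "0 < \<delta> z" using c_pos elim by (meson less_le_trans mult_pos_pos)
      then have "(1 / \<delta> z) powr p = \<delta> z powr - p"
        by (simp add: powr_divide powr_minus_divide)
      also have "\<dots> \<le> c powr - p * (\<bar>snd z + \<gamma> (fst z)\<bar> powr - \<alpha> * (\<bar>fst z\<bar> ^ m) powr - (p - \<alpha>))"
        using c_pos pos elim \<alpha>_bounds by (intro powr_neg_le_interpolation) auto
      also have "(\<bar>fst z\<bar> ^ m) powr - (p - \<alpha>) = \<bar>fst z\<bar> powr - (m * (p - \<alpha>))"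
        using z_generic by (simp add: powr_powr right_diff_distrib flip: powr_realpow)
      finally show "0 \<le> 1 / \<delta> z \<and> (1 / \<delta> z) powr p \<le> G z"
        using \<open>0 < \<delta> z\<close> by (simp add: G_def)
    qed
  qed
  ultimately show thesis by (rule that)
qed

lemma sum_inverse_distances_powr_majorant:
  fixes \<delta> :: "'i \<Rightarrow> real \<times> real \<Rightarrow> real" and \<gamma> :: "'i \<Rightarrow> real \<Rightarrow> real" and m :: "'i \<Rightarrow> nat" and p :: real
  assumes finite_I: "finite I" and p_bounds: "1 \<le> p" "\<And>j. j \<in> I \<Longrightarrow> m j * (p - 1) < 1"
    and \<gamma>_cont: "\<And>j. j \<in> I \<Longrightarrow> continuous_on UNIV (\<gamma> j)"
    and \<delta>_ge: "\<And>j. j \<in> I \<Longrightarrow> \<exists>c>0. \<forall>\<^sub>F z in nhds (0, 0).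
      c * \<bar>snd z + \<gamma> j (fst z)\<bar> \<le> \<delta> j z \<and> c * \<bar>fst z\<bar> ^ m j \<le> \<delta> j z"
  obtains G where "integrable_on_squares G"
    "\<forall>\<^sub>F z in nhds (0, 0). fst z \<noteq> 0 \<and> (\<forall>j\<in>I. snd z \<noteq> - \<gamma> j (fst z)) \<longrightarrow>
      0 \<le> 1 + (\<Sum>j\<in>I. 1 / \<delta> j z) \<and> (1 + (\<Sum>j\<in>I. 1 / \<delta> j z)) powr p \<le> G z"
proof -
  define majorant where "majorant j G \<longleftrightarrow> integrable_on_squares G \<and>
      (\<forall>\<^sub>F z in nhds (0, 0). fst z \<noteq> 0 \<and> snd z \<noteq> - \<gamma> j (fst z) \<longrightarrow> 0 \<le> 1 / \<delta> j z \<and> (1 / \<delta> j z) powr p \<le> G z)"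
    for j G
  have "\<exists>G. majorant j G" if j_in: "j \<in> I" for j
  proof -
    obtain c where "0 < c" "\<forall>\<^sub>F z in nhds (0, 0).
        c * \<bar>snd z + \<gamma> j (fst z)\<bar> \<le> \<delta> j z \<and> c * \<bar>fst z\<bar> ^ m j \<le> \<delta> j z"
      using \<delta>_ge[OF j_in] by blast
    from inverse_distance_powr_majorant[OF \<gamma>_cont[OF j_in] p_bounds(1) p_bounds(2)[OF j_in] this] show ?thesis
      unfolding majorant_def by blast
  qed
  then obtain G where G_majorant: "\<And>j. j \<in> I \<Longrightarrow> majorant j (G j)" by metis
  define H where "H z = (1 + card I) powr p * (1 + (\<Sum>j\<in>I. G j z))" for z
  have "integrable_on_squares H"
    using G_majorant unfolding H_def majorant_def by (intro integrable_on_squares_cmult_one_plus_sum) blast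
  moreover have "\<forall>\<^sub>F z in nhds (0, 0). \<forall>j\<in>I. fst z \<noteq> 0 \<and> snd z \<noteq> - \<gamma> j (fst z) \<longrightarrow>
      0 \<le> 1 / \<delta> j z \<and> (1 / \<delta> j z) powr p \<le> G j z"
    using finite_I G_majorant by (intro eventually_ball_finite) (auto simp: majorant_def)
  then have "\<forall>\<^sub>F z in nhds (0, 0). fst z \<noteq> 0 \<and> (\<forall>j\<in>I. snd z \<noteq> - \<gamma> j (fst z)) \<longrightarrow>
      0 \<le> 1 + (\<Sum>j\<in>I. 1 / \<delta> j z) \<and> (1 + (\<Sum>j\<in>I. 1 / \<delta> j z)) powr p \<le> H z"
  proof eventually_elim
    case (elim z)
    show ?case
    proof
      assume z_generic: "fst z \<noteq> 0 \<and> (\<forall>j\<in>I. snd z \<noteq> - \<gamma> j (fst z))"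
      have "(1 + (\<Sum>j\<in>I. 1 / \<delta> j z)) powr p \<le> (1 + card I) powr p * (1 + (\<Sum>j\<in>I. (1 / \<delta> j z) powr p))"
        using elim z_generic p_bounds(1) by (intro one_plus_sum_powr_le finite_I) auto
      also have "(\<Sum>j\<in>I. (1 / \<delta> j z) powr p) \<le> (\<Sum>j\<in>I. G j z)"
        using elim z_generic by (intro sum_mono) auto
      finally have "(1 + (\<Sum>j\<in>I. 1 / \<delta> j z)) powr p \<le> H z" by (simp add: H_def mult_left_mono)
      moreover have "0 \<le> (\<Sum>j\<in>I. 1 / \<delta> j z)" using elim z_generic by (intro sum_nonneg) auto
      ultimately show "0 \<le> 1 + (\<Sum>j\<in>I. 1 / \<delta> j z) \<and> (1 + (\<Sum>j\<in>I. 1 / \<delta> j z)) powr p \<le> H z" by simp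
    qed
  qed
  ultimately show thesis by (rule that)
qed

lemma Lp_loc_if_powr_norm_le:
  fixes F :: "real \<times> real \<Rightarrow> complex" and p :: real
  assumes W_nhd: "open W" "(0, 0) \<in> W" "F \<in> borel_measurable (lebesgue_on W)"
    and H_integrable: "integrable_on_squares H"
    and AE_generic: "AE z in lborel. generic z"
    and F_le: "\<forall>\<^sub>F z in nhds (0, 0). generic z \<longrightarrow> norm (F z) powr p \<le> H z"
  shows "Lp_loc p F"
proof -
  have "\<forall>\<^sub>F z in nhds (0, 0). z \<in> W" using W_nhd by (simp add: eventually_nhds_in_open)
  with F_le have "\<forall>\<^sub>F z in nhds (0, 0). z \<in> W \<and> (generic z \<longrightarrow> norm (F z) powr p \<le> H z)"
    by eventually_elim simp
  from eventually_happens'[OF _ eventually_conj[OF eventually_nhds_Pair_cball[OF this]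
        eventually_at_right_less]]
  obtain s :: real where s_pos: "0 < s" and box: "\<And>x y. \<bar>x\<bar> \<le> s \<Longrightarrow> \<bar>y\<bar> \<le> s \<Longrightarrow>
      (x, y) \<in> W \<and> (generic (x, y) \<longrightarrow> norm (F (x, y)) powr p \<le> H (x, y))"
    by auto
  let ?S = "ball 0 s \<times> ball 0 s :: (real \<times> real) set"
  have S_nhd: "open ?S" "(0, 0) \<in> ?S" "?S \<subseteq> W" using s_pos box by (auto intro: open_Times)
  have F_measurable: "F \<in> borel_measurable (lebesgue_on ?S)"
    using W_nhd(3) S_nhd(3) by (rule measurable_restrict_mono)
  have "AE z in lebesgue_on ?S. generic z"
    using AE_completion[OF AE_generic] S_nhd(1) by (subst AE_restrict_space_iff) (auto elim: eventually_mono)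
  moreover have "AE z in lebesgue_on ?S. z \<in> ?S"
    by (rule AE_I2) (simp add: space_restrict_space)
  ultimately have "AE z in lebesgue_on ?S. norm (norm (F z) powr p) \<le> norm (H z)"
    by eventually_elim (use box in \<open>force simp: mem_Times_iff\<close>)
  moreover have "(\<lambda>z. norm (F z) powr p) \<in> borel_measurable (lebesgue_on ?S)"
    using F_measurable by measurable
  moreover have "integrable (lebesgue_on ?S) H" using H_integrable by (simp add: integrable_on_squares_def)
  ultimately have "integrable (lebesgue_on ?S) (\<lambda>z. norm (F z) powr p)"
    using Bochner_Integration.integrable_bound by blast
  with S_nhd F_measurable show ?thesis unfolding Lp_loc_def by blast
qed

lemma Lp_loc_if_norm_le_inverse_distances:
  fixes F :: "real \<times> real \<Rightarrow> complex" and \<delta> :: "'i \<Rightarrow> real \<times> real \<Rightarrow> real"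
    and \<gamma> :: "'i \<Rightarrow> real \<Rightarrow> real" and m :: "'i \<Rightarrow> nat" and p :: real
  assumes finite_I: "finite I" and p_bounds: "1 \<le> p" "\<And>j. j \<in> I \<Longrightarrow> m j * (p - 1) < 1"
    and W_nhd: "open W" "(0, 0) \<in> W" "F \<in> borel_measurable (lebesgue_on W)"
    and B_bound: "0 \<le> B" "\<forall>\<^sub>F z in nhds (0, 0). fst z \<noteq> 0 \<longrightarrow> norm (F z) \<le> B * (1 + (\<Sum>j\<in>I. 1 / \<delta> j z))"
    and \<gamma>_cont: "\<And>j. j \<in> I \<Longrightarrow> continuous_on UNIV (\<gamma> j)"
    and \<delta>_ge: "\<And>j. j \<in> I \<Longrightarrow> \<exists>c>0. \<forall>\<^sub>F z in nhds (0, 0).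
      c * \<bar>snd z + \<gamma> j (fst z)\<bar> \<le> \<delta> j z \<and> c * \<bar>fst z\<bar> ^ m j \<le> \<delta> j z"
  shows "Lp_loc p F"
proof -
  let ?generic = "\<lambda>z. fst z \<noteq> 0 \<and> (\<forall>j\<in>I. snd z \<noteq> - \<gamma> j (fst z))"
  obtain G where G_integrable: "integrable_on_squares G"
    and G_ge: "\<forall>\<^sub>F z in nhds (0, 0). ?generic z \<longrightarrow>
      0 \<le> 1 + (\<Sum>j\<in>I. 1 / \<delta> j z) \<and> (1 + (\<Sum>j\<in>I. 1 / \<delta> j z)) powr p \<le> G z"
    using sum_inverse_distances_powr_majorant[where m = m and \<gamma> = \<gamma> and \<delta> = \<delta>,
        OF finite_I p_bounds \<gamma>_cont \<delta>_ge] by blast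
  show ?thesis
  proof (rule Lp_loc_if_powr_norm_le[OF W_nhd])
    show "integrable_on_squares (\<lambda>z. B powr p * G z)"
      using G_integrable by (simp add: integrable_on_squares_def)
    show "AE z in lborel. ?generic z"
      by (intro AE_lborel_off_axis_and_graphs finite_I borel_measurable_continuous_onI
          continuous_intros \<gamma>_cont)
    from B_bound(2) G_ge show "\<forall>\<^sub>F z in nhds (0, 0). ?generic z \<longrightarrow> norm (F z) powr p \<le> B powr p * G z"
    proof eventually_elim
      case (elim z)
      show ?case
      proof
        assume z_generic: "?generic z"
        then have "norm (F z) powr p \<le> (B * (1 + (\<Sum>j\<in>I. 1 / \<delta> j z))) powr p"
          using elim(1) p_bounds(1) by (intro powr_mono2) auto
        also have "\<dots> = B powr p * (1 + (\<Sum>j\<in>I. 1 / \<delta> j z)) powr p"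
          using elim(2) z_generic B_bound(1) by (intro powr_mult)
        also have "\<dots> \<le> B powr p * G z"
          using elim(2) z_generic by (intro mult_left_mono) auto
        finally show "norm (F z) powr p \<le> B powr p * G z" .
      qed
    qed
  qed
qed

subsection \<open>The derivative of the quotient\<close>

lemma lower_half_plane_branches_if_factorization:
  fixes P u :: "complex \<Rightarrow> complex \<Rightarrow> complex" and I :: "'i set"
    and q :: "'i \<Rightarrow> real poly" and m :: "'i \<Rightarrow> nat" and \<psi> :: "'i \<Rightarrow> complex \<Rightarrow> complex"
  assumes "conv2 P" and "conv2 u" "u 0 0 \<noteq> 0" and "finite I"
    and "zorder (P 0) 0 = int (card I)"
    and even_m: "\<And>j. j \<in> I \<Longrightarrow> even (m j)"
    and \<tau>_branch: "\<And>x. \<tau> x ^ k = of_real x" "\<tau> 0 = 0" "isCont \<tau> 0"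
    and \<psi>_branch: "\<And>j. j \<in> I \<Longrightarrow> isCont (\<psi> j \<circ> \<tau>) 0" "\<And>j. j \<in> I \<Longrightarrow> 0 < Im ((\<psi> j \<circ> \<tau>) 0)"
    and factor: "\<forall>\<^sub>F z in nhds (0, 0). P (fst z ^ k) (snd z) = u (fst z ^ k) (snd z) *
      (\<Prod>j\<in>I. snd z + poly (map_poly complex_of_real (q j)) (fst z ^ k) + (fst z ^ k) ^ m j * \<psi> j (fst z))"
  shows "lower_half_plane_branches P u (\<lambda>j. root_branch (poly (q j)) (m j) (\<psi> j \<circ> \<tau>)) I"
proof
  fix j assume j_in: "j \<in> I"
  show "isCont (root_branch (poly (q j)) (m j) (\<psi> j \<circ> \<tau>)) 0"
    using poly_isCont \<psi>_branch(1)[OF j_in] by (rule isCont_root_branch)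
  show "\<forall>\<^sub>F x in nhds 0. x \<noteq> 0 \<longrightarrow> Im (root_branch (poly (q j)) (m j) (\<psi> j \<circ> \<tau>) x) < 0"
    using \<psi>_branch[OF j_in] even_m[OF j_in] by (rule eventually_Im_root_branch_neg)
next
  have "isCont (\<lambda>z. (\<tau> (fst z), snd z)) (0, 0 :: complex)"
    using \<tau>_branch(3) by (intro continuous_intros isCont_o2[where f = fst and g = \<tau>]) auto
  from eventually_nhds_compose_isCont[OF factor this] \<tau>_branch(2)
  show "\<forall>\<^sub>F z in nhds (0, 0). P (of_real (fst z)) (snd z) = u (of_real (fst z)) (snd z) *
      (\<Prod>j\<in>I. snd z - root_branch (poly (q j)) (m j) (\<psi> j \<circ> \<tau>) (fst z))"
    by (simp add: \<tau>_branch(1) root_branch_def poly_map_poly_of_real algebra_simps)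
qed (use assms in auto)

lemma Lp_loc_dy_quotient_if_root_branches:
  fixes P Q u :: "complex \<Rightarrow> complex \<Rightarrow> complex" and I :: "'i set" and \<gamma> :: "'i \<Rightarrow> real \<Rightarrow> real"
    and m :: "'i \<Rightarrow> nat" and \<phi> :: "'i \<Rightarrow> real \<Rightarrow> complex" and p :: real
  assumes branches: "lower_half_plane_branches P u (\<lambda>j. root_branch (\<gamma> j) (m j) (\<phi> j)) I"
    and \<gamma>_cont: "\<And>j. j \<in> I \<Longrightarrow> continuous_on UNIV (\<gamma> j)"
    and \<phi>_branch: "\<And>j. j \<in> I \<Longrightarrow> isCont (\<phi> j) 0" "\<And>j. j \<in> I \<Longrightarrow> Im (\<phi> j 0) \<noteq> 0"
    and p_bounds: "1 \<le> p" "\<And>j. j \<in> I \<Longrightarrow> m j * (p - 1) < 1"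
    and Q_conv: "conv2 Q" and bounded: "Linf_loc (\<lambda>z. restrR2 Q z / restrR2 P z)"
  shows "Lp_loc p (dy (\<lambda>z. restrR2 Q z / restrR2 P z))"
proof -
  interpret lower_half_plane_branches P u "\<lambda>j. root_branch (\<gamma> j) (m j) (\<phi> j)" I
    by (rule branches)
  obtain W where W_nhd: "open W" "(0, 0) \<in> W" "dy (quotient Q) \<in> borel_measurable (lebesgue_on W)"
    using borel_measurable_dy_quotient[OF Q_conv] by blast
  obtain B where B_bound: "0 \<le> B" "\<forall>\<^sub>F z in nhds (0, 0). fst z \<noteq> 0 \<longrightarrow> norm (dy (quotient Q) z)
      \<le> B * (1 + (\<Sum>j\<in>I. 1 / norm (of_real (snd z) - root_branch (\<gamma> j) (m j) (\<phi> j) (fst z))))"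
    using eventually_norm_dy_quotient_le[OF Q_conv bounded] by blast
  show ?thesis
    using finite_I p_bounds W_nhd B_bound \<gamma>_cont eventually_norm_diff_root_branch_ge[OF \<phi>_branch]
    by (rule Lp_loc_if_norm_le_inverse_distances)
qed

lemma mult_exponent_diff_less_one:
  fixes m K :: nat and p :: real
  assumes "m \<le> K" "1 \<le> p" "real K * p < real K + 1"
  shows "m * (p - 1) < 1"
proof -
  have "m * (p - 1) \<le> K * (p - 1)" using assms by (intro mult_right_mono) auto
  with assms(3) show ?thesis by (simp add: algebra_simps)
qed

theorem theorem6p3:
  fixes P Q u :: "complex \<Rightarrow> complex \<Rightarrow> complex"
    and M k :: nat and L :: "nat \<Rightarrow> nat" and q :: "nat \<Rightarrow> real poly"
    and \<psi> :: "nat \<Rightarrow> complex \<Rightarrow> complex"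
  assumes P_conv: "conv2 P"
    and P0: "\<not> (\<forall>\<^sub>F y in nhds 0. P 0 y = 0)"
    and no_zeros: "\<exists>U. open U \<and> (0,0) \<in> U \<and>
        (\<forall>(x::real) y. (complex_of_real x, y) \<in> U \<and> Im y > 0 \<longrightarrow> P (complex_of_real x) y \<noteq> 0)"
    and coprime: "no_common_factor P (conj2 P)"
    and M_def: "int M = zorder (\<lambda>y. P 0 y) 0"
    and u_unit: "conv2 u" "u 0 0 \<noteq> 0"
    and k_pos: "k \<ge> 1"
    and q0: "\<And>j. j < M \<Longrightarrow> poly (q j) 0 = 0"
    and q_deg: "\<And>j. j < M \<Longrightarrow> q j = 0 \<or> degree (q j) < 2 * L j"
    and \<psi>_conv: "\<And>j. j < M \<Longrightarrow> conv1 (\<psi> j)"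
    and \<psi>_im: "\<And>j. j < M \<Longrightarrow> Im (\<psi> j 0) > 0"
    and factor: "\<forall>\<^sub>F z in nhds (0,0). P (fst z ^ k) (snd z) =
        u (fst z ^ k) (snd z) * (\<Prod>j<M. snd z + poly (map_poly complex_of_real (q j)) (fst z ^ k)
                                        + (fst z ^ k) ^ (2 * L j) * \<psi> j (fst z))"
    and Q_conv: "conv2 Q"
    and QP_bdd: "Linf_loc (\<lambda>z. restrR2 Q z / restrR2 P z)"
  shows "\<forall>p::real. 1 \<le> p \<and> real (Max (insert 0 ((\<lambda>j. 2 * L j) ` {..<M}))) * p
                          < real (Max (insert 0 ((\<lambda>j. 2 * L j) ` {..<M}))) + 1
           \<longrightarrow> Lp_loc p (dy (\<lambda>z. restrR2 Q z / restrR2 P z))"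
proof (intro allI impI, elim conjE)
  fix p :: real
  let ?K = "Max (insert 0 ((\<lambda>j. 2 * L j) ` {..<M}))"
  assume p_ge: "1 \<le> p" and K_p: "real ?K * p < real ?K + 1"
  obtain \<tau> where \<tau>_branch: "\<And>x. \<tau> x ^ k = complex_of_real x" "\<tau> 0 = 0" "isCont \<tau> 0"
    using real_root_branch[OF k_pos] by blast
  have \<psi>_\<tau>: "isCont (\<psi> j \<circ> \<tau>) 0" "0 < Im ((\<psi> j \<circ> \<tau>) 0)" if "j < M" for j
    using conv1_isCont[OF \<psi>_conv[OF that]] \<psi>_im[OF that] \<tau>_branch(2,3) continuous_at_compose[of 0 \<tau> "\<psi> j"]
    by simp_all
  have branches: "lower_half_plane_branches P u (\<lambda>j. root_branch (poly (q j)) (2 * L j) (\<psi> j \<circ> \<tau>)) {..<M}"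
    using P_conv u_unit M_def \<psi>_\<tau> \<tau>_branch factor by (intro lower_half_plane_branches_if_factorization) auto
  have exponent: "real (2 * L j) * (p - 1) < 1" if "j < M" for j
    using that by (intro mult_exponent_diff_less_one[OF _ p_ge K_p] Max_ge) auto
  show "Lp_loc p (dy (\<lambda>z. restrR2 Q z / restrR2 P z))"
  proof (rule Lp_loc_dy_quotient_if_root_branches[OF branches _ _ _ p_ge _ Q_conv QP_bdd])
    show "continuous_on UNIV (poly (q j))" for j by (intro continuous_intros)
    show "isCont (\<psi> j \<circ> \<tau>) 0" "Im ((\<psi> j \<circ> \<tau>) 0) \<noteq> 0" "real (2 * L j) * (p - 1) < 1"
      if "j \<in> {..<M}" for j
      using \<psi>_\<tau>[of j] exponent[of j] that by auto
  qed
qed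

end
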